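(* Let $M$ be an oriented smooth manifold of dimension $n\ge 3$, possibly with boundary, with a conformal class of Riemannian metrics. Let $\beta\in\Omega^{n-1}(M)$ be a closed, nowhere vanishing $(n-1)$-form with $j_{\partial M}^*\beta=\beta_{\partial M}$ for a given $\beta_{\partial M}\in\Omega^{n-1}(\partial M)$, where $j_{\partial M}:\partial M\to M$ is the inclusion. Let $\hat g$ and $\bar g$ be two metrics in the conformal class related by $\bar g=|\beta|_{\hat g}^2\,\hat g$. Then: (i) $\beta$ is force-free with respect to $\hat g$ if and only if $\beta$ is geodesic with respect to $\bar g$. (ii) $\beta$ is harmonic with respect to $\hat g$ if and only if $\beta$ is eikonal with respect to $\bar g$. (iii) $\beta$ is exact harmonic with respect to $\hat g$ if and only if $\beta$ is exact eikonal with respect to $\bar g$.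
   Context: All objects are smooth. Two Riemannian metrics $g,h$ are conformally equivalent if $h=e^{2u}g$ for some $u\in C^\infty(M)$. Given a metric $g$ with volume form $\mu$, Hodge star $\star$, Levi-Civita connection $\nabla$ and pointwise norm $|\omega|_g^2=\star(\omega\wedge\star\omega)$ on forms, the vector field $B$ associated to $\beta$ is defined by $\iota_B\mu=\beta$. With respect to $g$, a closed form $\beta\in\Omega^{n-1}(M)$ is: force-free if $\iota_Bd\star\beta=0$; geodesic if $\nabla_BB=\rho B$ for some $\rho\in C^\infty(M)$; harmonic if $d\star\beta=0$; exact harmonic if $\beta=\star d\phi$ for some $\phi\in C^\infty(M)$; eikonal (resp. exact eikonal) if there exists a closed (resp. exact) normalization $\eta\in\Omega^1(M)$ of $\star\beta$. Here a normalization of $\alpha\in\Omega^k(M)$ is a form $\xi\in\Omega^k(M)$ with $|\alpha|\,\xi=\alpha$ and $|\xi|\le1$. *)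

theory Defs
  imports "HOL-Analysis.Analysis"
begin

section \<open>Smooth maps on arbitrary subsets of Euclidean space\<close>

primrec Ck_on :: "nat \<Rightarrow> 'a::euclidean_space set \<Rightarrow> ('a \<Rightarrow> 'b::real_normed_vector) \<Rightarrow> bool" where
  "Ck_on 0 U f \<longleftrightarrow> continuous_on U f"
| "Ck_on (Suc k) U f \<longleftrightarrow> (\<forall>x\<in>U. f differentiable (at x)) \<and>
     (\<forall>v. Ck_on k U (\<lambda>x. frechet_derivative f (at x) v))"

text \<open>On a set that need not be open (such as a relatively open subset of a half-space), smooth
  means: locally the restriction of a smooth function on an open set of the ambient space.\<close>

definition smooth_on :: "'a::euclidean_space set \<Rightarrow> ('a \<Rightarrow> 'b::real_normed_vector) \<Rightarrow> bool" where
  "smooth_on S f \<longleftrightarrow> (\<forall>x\<in>S. \<exists>U F. open U \<and> x \<in> U \<and> (\<forall>k. Ck_on k U F) \<and> (\<forall>y\<in>S \<inter> U. f y = F y))"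


section \<open>Oriented smooth manifolds with boundary\<close>

text \<open>The dimension is \<open>CARD('n)\<close>. The linear order on the index type \<open>'n\<close> fixes the standard
  orientation of \<open>real ^ 'n\<close>; the last coordinate is the one that is nonnegative on the half-space.
  A chart is a pair of its domain and its coordinate map.\<close>

type_synonym ('m, 'n) chart = "'m set \<times> ('m \<Rightarrow> real ^ 'n)"

definition half_space :: "(real ^ 'n::{finite,linorder}) set" where
  "half_space = {x. 0 \<le> x $ Max UNIV}"

definition boundary_hyperplane :: "(real ^ 'n::{finite,linorder}) set" where
  "boundary_hyperplane = {x. x $ Max UNIV = 0}"

definition coord_dom :: "('m, 'n::finite) chart \<Rightarrow> (real ^ 'n) set" where
  "coord_dom c = snd c ` fst c"

definition param :: "('m, 'n::finite) chart \<Rightarrow> real ^ 'n \<Rightarrow> 'm" where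
  "param c = inv_into (fst c) (snd c)"

definition is_chart :: "'m topology \<Rightarrow> ('m, 'n::{finite,linorder}) chart \<Rightarrow> bool" where
  "is_chart X c \<longleftrightarrow> openin X (fst c) \<and> openin (top_of_set half_space) (coord_dom c) \<and>
     homeomorphic_map (subtopology X (fst c)) (top_of_set (coord_dom c)) (snd c)"

definition overlap :: "('m, 'n::finite) chart \<Rightarrow> ('m, 'n) chart \<Rightarrow> (real ^ 'n) set" where
  "overlap c d = snd c ` (fst c \<inter> fst d)"

definition transition :: "('m, 'n::finite) chart \<Rightarrow> ('m, 'n) chart \<Rightarrow> real ^ 'n \<Rightarrow> real ^ 'n" where
  "transition c d = snd d \<circ> param c"

definition transition_deriv ::
    "('m, 'n::finite) chart \<Rightarrow> ('m, 'n) chart \<Rightarrow> real ^ 'n \<Rightarrow> real ^ 'n \<Rightarrow> real ^ 'n" where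
  "transition_deriv c d x = frechet_derivative (transition c d) (at x within overlap c d)"

text \<open>Derivatives within relatively open subsets of the half-space are unique, also at boundary
  points, and agree there with the derivative of any smooth extension.\<close>

definition oriented_manifold_with_boundary ::
    "'m topology \<Rightarrow> ('m, 'n::{finite,linorder}) chart set \<Rightarrow> bool" where
  "oriented_manifold_with_boundary X A \<longleftrightarrow>
     Hausdorff_space X \<and> second_countable X \<and>
     (\<forall>c\<in>A. is_chart X c) \<and> topspace X = (\<Union>c\<in>A. fst c) \<and>
     (\<forall>c\<in>A. \<forall>d\<in>A. smooth_on (overlap c d) (transition c d) \<and>
        (\<forall>x\<in>overlap c d. 0 < det (matrix (transition_deriv c d x))))"

definition smooth_fun :: "('m, 'n::finite) chart set \<Rightarrow> ('m \<Rightarrow> real) \<Rightarrow> bool" where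
  "smooth_fun A u \<longleftrightarrow> (\<forall>c\<in>A. smooth_on (coord_dom c) (\<lambda>x. u (param c x)))"


section \<open>Alternating forms on a vector space\<close>

text \<open>A \<open>k\<close>-form at a point is a function of a sequence of vectors that depends only on the
  arguments with index \<open>0, \<dots>, k - 1\<close> and is multilinear and alternating in them.
  The vectors range over a linear subspace \<open>W\<close>: the whole space for the tangent spaces of the
  manifold, and the hyperplane for those of its boundary.\<close>

type_synonym 'n multi_form = "(nat \<Rightarrow> real ^ 'n) \<Rightarrow> real"
type_synonym 'n matrix = "real ^ 'n ^ 'n"

definition alternating_form ::
    "(real ^ 'n::finite) set \<Rightarrow> nat \<Rightarrow> 'n multi_form \<Rightarrow> bool" where
  "alternating_form W k \<omega> \<longleftrightarrow>
     (\<forall>v w. range v \<subseteq> W \<longrightarrow> range w \<subseteq> W \<longrightarrow> (\<forall>i<k. v i = w i) \<longrightarrow> \<omega> v = \<omega> w) \<and>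
     (\<forall>v. range v \<subseteq> W \<longrightarrow> (\<forall>i<k. \<forall>x\<in>W. \<forall>y\<in>W. \<forall>a b.
        \<omega> (v(i := a *\<^sub>R x + b *\<^sub>R y)) = a * \<omega> (v(i := x)) + b * \<omega> (v(i := y)))) \<and>
     (\<forall>v. range v \<subseteq> W \<longrightarrow> (\<forall>i<k. \<forall>j<k. i \<noteq> j \<and> v i = v j \<longrightarrow> \<omega> v = 0))"

definition wedge :: "nat \<Rightarrow> nat \<Rightarrow> 'n::finite multi_form \<Rightarrow> 'n multi_form \<Rightarrow> 'n multi_form" where
  "wedge k l \<alpha> \<beta> v = (\<Sum>\<sigma> | \<sigma> permutes {..<k + l}.
       of_int (sign \<sigma>) * \<alpha> (\<lambda>i. v (\<sigma> i)) * \<beta> (\<lambda>i. v (\<sigma> (k + i)))) / (fact k * fact l)"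

definition contract :: "real ^ 'n::finite \<Rightarrow> 'n multi_form \<Rightarrow> 'n multi_form" where
  "contract b \<omega> v = \<omega> (case_nat b v)"

text \<open>In what follows \<open>G\<close> is the matrix \<open>(g\<^sub>i\<^sub>j)\<close> of an inner product. The volume form is
  \<open>\<surd>det G dx\<^sup>1 \<and> \<dots> \<and> dx\<^sup>n\<close>; the number of indices below \<open>i\<close> is the position of \<open>i\<close>.\<close>

definition volume_form :: "'n::{finite,linorder} matrix \<Rightarrow> 'n multi_form" where
  "volume_form G v = sqrt (det G) * det (\<chi> i. v (card {j. j < i}))"

text \<open>The index formula
  \<open>(\<star>\<omega>)\<^sub>j\<^sub>1\<^sub>\<dots> = 1/k! \<Sum> \<omega>\<^sup>i\<^sup>1\<^sup>\<dots>\<^sup>i\<^sup>k \<mu>\<^sub>i\<^sub>1\<^sub>\<dots>\<^sub>i\<^sub>k\<^sub>j\<^sub>1\<^sub>\<dots>\<close>, in the convention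
  \<open>\<alpha> \<and> \<star>\<omega> = \<langle>\<alpha>, \<omega>\<rangle> \<mu>\<close>. Indices of \<open>\<omega>\<close> are raised by evaluating it on the
  vectors \<open>G\<^sup>-\<^sup>1 e\<^sub>i\<close>, the metric duals of the \<open>dx\<^sup>i\<close>.\<close>

definition hodge :: "'n::{finite,linorder} matrix \<Rightarrow> nat \<Rightarrow> 'n multi_form \<Rightarrow> 'n multi_form" where
  "hodge G k \<omega> w =
     (\<Sum>I\<in>{..<k} \<rightarrow>\<^sub>E (UNIV :: 'n set).
        \<omega> (\<lambda>a. matrix_inv G *v axis (I a) 1) *
        volume_form G (\<lambda>a. if a < k then axis (I a) 1 else w (a - k))) / fact k"

text \<open>\<open>\<bar>\<omega>\<bar>\<^sup>2 = \<star>(\<omega> \<and> \<star>\<omega>)\<close>, a \<open>0\<close>-form, hence a function of no vectors.\<close>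

definition form_norm :: "'n::{finite,linorder} matrix \<Rightarrow> nat \<Rightarrow> 'n multi_form \<Rightarrow> real" where
  "form_norm G k \<omega> =
     sqrt (hodge G CARD('n) (wedge k (CARD('n) - k) \<omega> (hodge G k \<omega>)) (\<lambda>_. 0))"


section \<open>Tensor fields\<close>

text \<open>A tensor field is given by its local representatives in the coordinates of each chart of the
  atlas, related by the tensorial transformation law on overlaps. Only the values at charts
  \<open>c \<in> A\<close> and points of \<open>coord_dom c\<close> are relevant.\<close>

type_synonym ('m, 'n) form_field = "('m, 'n) chart \<Rightarrow> real ^ 'n \<Rightarrow> 'n multi_form"
type_synonym ('m, 'n) metric_field = "('m, 'n) chart \<Rightarrow> real ^ 'n \<Rightarrow> 'n matrix"
type_synonym ('m, 'n) vec_field = "('m, 'n) chart \<Rightarrow> real ^ 'n \<Rightarrow> real ^ 'n"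

text \<open>Forms on the submanifold whose coordinate expression in the chart \<open>c\<close> is
  \<open>coord_dom c \<inter> W\<close>.\<close>

definition diff_form_on ::
    "(real ^ 'n::finite) set \<Rightarrow> ('m, 'n) chart set \<Rightarrow> nat \<Rightarrow> ('m, 'n) form_field \<Rightarrow> bool" where
  "diff_form_on W A k \<omega> \<longleftrightarrow>
     (\<forall>c\<in>A. \<forall>x\<in>coord_dom c \<inter> W. alternating_form W k (\<omega> c x)) \<and>
     (\<forall>c\<in>A. \<forall>v. range v \<subseteq> W \<longrightarrow> smooth_on (coord_dom c \<inter> W) (\<lambda>x. \<omega> c x v)) \<and>
     (\<forall>c\<in>A. \<forall>d\<in>A. \<forall>x\<in>overlap c d \<inter> W. \<forall>v. range v \<subseteq> W \<longrightarrow>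
        \<omega> c x v = \<omega> d (transition c d x) (\<lambda>i. transition_deriv c d x (v i)))"

definition diff_form :: "('m, 'n::finite) chart set \<Rightarrow> nat \<Rightarrow> ('m, 'n) form_field \<Rightarrow> bool" where
  "diff_form A k \<omega> \<longleftrightarrow> diff_form_on UNIV A k \<omega>"

definition boundary_diff_form ::
    "('m, 'n::{finite,linorder}) chart set \<Rightarrow> nat \<Rightarrow> ('m, 'n) form_field \<Rightarrow> bool" where
  "boundary_diff_form A k \<omega> \<longleftrightarrow> diff_form_on boundary_hyperplane A k \<omega>"

text \<open>\<open>j\<^sup>*\<omega> = \<gamma>\<close> for the inclusion \<open>j\<close> of the boundary.\<close>

definition boundary_pullback_eq ::
    "('m, 'n::{finite,linorder}) chart set \<Rightarrow> ('m, 'n) form_field \<Rightarrow> ('m, 'n) form_field \<Rightarrow> bool" where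
  "boundary_pullback_eq A \<omega> \<gamma> \<longleftrightarrow>
     (\<forall>c\<in>A. \<forall>x\<in>coord_dom c \<inter> boundary_hyperplane. \<forall>v.
        range v \<subseteq> boundary_hyperplane \<longrightarrow> \<omega> c x v = \<gamma> c x v)"

definition form_eq ::
    "('m, 'n::finite) chart set \<Rightarrow> ('m, 'n) form_field \<Rightarrow> ('m, 'n) form_field \<Rightarrow> bool" where
  "form_eq A \<omega> \<eta> \<longleftrightarrow> (\<forall>c\<in>A. \<forall>x\<in>coord_dom c. \<omega> c x = \<eta> c x)"

definition zero_form :: "('m, 'n::finite) form_field" where
  "zero_form c x v = 0"

definition nowhere_vanishing :: "('m, 'n::finite) chart set \<Rightarrow> ('m, 'n) form_field \<Rightarrow> bool" where
  "nowhere_vanishing A \<omega> \<longleftrightarrow> (\<forall>c\<in>A. \<forall>x\<in>coord_dom c. \<omega> c x \<noteq> (\<lambda>v. 0))"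

definition fun_form :: "('m \<Rightarrow> real) \<Rightarrow> ('m, 'n::finite) form_field" where
  "fun_form u c x v = u (param c x)"

text \<open>\<open>(d\<omega>)(v\<^sub>0, \<dots>, v\<^sub>k) = \<Sum>\<^sub>i (-1)\<^sup>i D\<omega>(v\<^sub>i)(v\<^sub>0, \<dots>, v\<^sub>i\<^sub>-\<^sub>1, v\<^sub>i\<^sub>+\<^sub>1, \<dots>, v\<^sub>k)\<close>
  in coordinates.\<close>

definition ext_d :: "nat \<Rightarrow> ('m, 'n::finite) form_field \<Rightarrow> ('m, 'n) form_field" where
  "ext_d k \<omega> c x v =
     (\<Sum>i\<le>k. (-1) ^ i *
        frechet_derivative (\<lambda>y. \<omega> c y (\<lambda>j. v (if j < i then j else Suc j)))
          (at x within coord_dom c) (v i))"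

definition closed_form :: "('m, 'n::finite) chart set \<Rightarrow> nat \<Rightarrow> ('m, 'n) form_field \<Rightarrow> bool" where
  "closed_form A k \<omega> \<longleftrightarrow> form_eq A (ext_d k \<omega>) zero_form"

definition exact_one_form :: "('m, 'n::finite) chart set \<Rightarrow> ('m, 'n) form_field \<Rightarrow> bool" where
  "exact_one_form A \<eta> \<longleftrightarrow> (\<exists>u. smooth_fun A u \<and> form_eq A \<eta> (ext_d 0 (fun_form u)))"


section \<open>Riemannian metrics\<close>

definition riemannian_metric :: "('m, 'n::finite) chart set \<Rightarrow> ('m, 'n) metric_field \<Rightarrow> bool" where
  "riemannian_metric A g \<longleftrightarrow>
     (\<forall>c\<in>A. smooth_on (coord_dom c) (g c)) \<and>
     (\<forall>c\<in>A. \<forall>x\<in>coord_dom c. transpose (g c x) = g c x \<and> (\<forall>v. v \<noteq> 0 \<longrightarrow> 0 < v \<bullet> (g c x *v v))) \<and>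
     (\<forall>c\<in>A. \<forall>d\<in>A. \<forall>x\<in>overlap c d. \<forall>v w.
        v \<bullet> (g c x *v w) =
        transition_deriv c d x v \<bullet> (g d (transition c d x) *v transition_deriv c d x w))"

definition conformally_equivalent ::
    "('m, 'n::finite) chart set \<Rightarrow> ('m, 'n) metric_field \<Rightarrow> ('m, 'n) metric_field \<Rightarrow> bool" where
  "conformally_equivalent A g h \<longleftrightarrow>
     (\<exists>u. smooth_fun A u \<and>
        (\<forall>c\<in>A. \<forall>x\<in>coord_dom c. h c x = exp (2 * u (param c x)) *\<^sub>R g c x))"

definition conformal_class ::
    "('m, 'n::finite) chart set \<Rightarrow> ('m, 'n) metric_field set \<Rightarrow> bool" where
  "conformal_class A C \<longleftrightarrow>
     (\<exists>g. riemannian_metric A g \<and> C = {h. riemannian_metric A h \<and> conformally_equivalent A g h})"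

definition star :: "('m, 'n) metric_field \<Rightarrow> nat \<Rightarrow> ('m, 'n::{finite,linorder}) form_field \<Rightarrow>
    ('m, 'n) form_field" where
  "star g k \<omega> c x = hodge (g c x) k (\<omega> c x)"

text \<open>The Levi-Civita connection in coordinates:
  \<open>\<Gamma>\<^sup>k\<^sub>i\<^sub>j = 1/2 g\<^sup>k\<^sup>l (\<partial>\<^sub>i g\<^sub>j\<^sub>l + \<partial>\<^sub>j g\<^sub>i\<^sub>l - \<partial>\<^sub>l g\<^sub>i\<^sub>j)\<close> and
  \<open>(\<nabla>\<^sub>Y Z)\<^sup>k = Y\<^sup>i \<partial>\<^sub>i Z\<^sup>k + \<Gamma>\<^sup>k\<^sub>i\<^sub>j Y\<^sup>i Z\<^sup>j\<close>.\<close>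

definition partial_deriv :: "(real ^ 'n::finite) set \<Rightarrow> 'n \<Rightarrow> (real ^ 'n \<Rightarrow> real) \<Rightarrow> real ^ 'n \<Rightarrow> real" where
  "partial_deriv S i f x = frechet_derivative f (at x within S) (axis i 1)"

definition christoffel :: "('m, 'n::finite) metric_field \<Rightarrow> ('m, 'n) chart \<Rightarrow> real ^ 'n \<Rightarrow>
    'n \<Rightarrow> 'n \<Rightarrow> 'n \<Rightarrow> real" where
  "christoffel g c x k i j =
     (\<Sum>l\<in>UNIV. matrix_inv (g c x) $ k $ l *
        (partial_deriv (coord_dom c) i (\<lambda>y. g c y $ j $ l) x +
         partial_deriv (coord_dom c) j (\<lambda>y. g c y $ i $ l) x -
         partial_deriv (coord_dom c) l (\<lambda>y. g c y $ i $ j) x)) / 2"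

definition levi_civita :: "('m, 'n::finite) metric_field \<Rightarrow> ('m, 'n) vec_field \<Rightarrow> ('m, 'n) vec_field \<Rightarrow>
    ('m, 'n) vec_field" where
  "levi_civita g Y Z c x =
     (\<chi> k. (\<Sum>i\<in>UNIV. Y c x $ i * partial_deriv (coord_dom c) i (\<lambda>y. Z c y $ k) x) +
          (\<Sum>i\<in>UNIV. \<Sum>j\<in>UNIV. christoffel g c x k i j * Y c x $ i * Z c x $ j))"


section \<open>Properties of an \<open>(n - 1)\<close>-form with respect to a metric\<close>

text \<open>The unique \<open>B\<close> with \<open>\<iota>\<^sub>B \<mu> = \<beta>\<close>.\<close>

definition assoc_field :: "('m, 'n) metric_field \<Rightarrow> ('m, 'n::{finite,linorder}) form_field \<Rightarrow>
    ('m, 'n) vec_field" where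
  "assoc_field g \<beta> c x = (THE b. contract b (volume_form (g c x)) = \<beta> c x)"

definition force_free :: "('m, 'n::{finite,linorder}) chart set \<Rightarrow> ('m, 'n) metric_field \<Rightarrow>
    ('m, 'n) form_field \<Rightarrow> bool" where
  "force_free A g \<beta> \<longleftrightarrow>
     form_eq A (\<lambda>c x. contract (assoc_field g \<beta> c x) (ext_d 1 (star g (CARD('n) - 1) \<beta>) c x)) zero_form"

definition geodesic_form :: "('m, 'n::{finite,linorder}) chart set \<Rightarrow> ('m, 'n) metric_field \<Rightarrow>
    ('m, 'n) form_field \<Rightarrow> bool" where
  "geodesic_form A g \<beta> \<longleftrightarrow>
     (\<exists>\<rho>. smooth_fun A \<rho> \<and>
        (\<forall>c\<in>A. \<forall>x\<in>coord_dom c.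
           levi_civita g (assoc_field g \<beta>) (assoc_field g \<beta>) c x =
           \<rho> (param c x) *\<^sub>R assoc_field g \<beta> c x))"

definition harmonic :: "('m, 'n::{finite,linorder}) chart set \<Rightarrow> ('m, 'n) metric_field \<Rightarrow>
    ('m, 'n) form_field \<Rightarrow> bool" where
  "harmonic A g \<beta> \<longleftrightarrow> form_eq A (ext_d 1 (star g (CARD('n) - 1) \<beta>)) zero_form"

definition exact_harmonic :: "('m, 'n::{finite,linorder}) chart set \<Rightarrow> ('m, 'n) metric_field \<Rightarrow>
    ('m, 'n) form_field \<Rightarrow> bool" where
  "exact_harmonic A g \<beta> \<longleftrightarrow>
     (\<exists>u. smooth_fun A u \<and> form_eq A \<beta> (star g 1 (ext_d 0 (fun_form u))))"

definition normalization :: "('m, 'n::{finite,linorder}) chart set \<Rightarrow> ('m, 'n) metric_field \<Rightarrow> nat \<Rightarrow>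
    ('m, 'n) form_field \<Rightarrow> ('m, 'n) form_field \<Rightarrow> bool" where
  "normalization A g k \<alpha> \<xi> \<longleftrightarrow>
     diff_form A k \<xi> \<and>
     form_eq A (\<lambda>c x v. form_norm (g c x) k (\<alpha> c x) * \<xi> c x v) \<alpha> \<and>
     (\<forall>c\<in>A. \<forall>x\<in>coord_dom c. form_norm (g c x) k (\<xi> c x) \<le> 1)"

definition eikonal :: "('m, 'n::{finite,linorder}) chart set \<Rightarrow> ('m, 'n) metric_field \<Rightarrow>
    ('m, 'n) form_field \<Rightarrow> bool" where
  "eikonal A g \<beta> \<longleftrightarrow>
     (\<exists>\<eta>. normalization A g 1 (star g (CARD('n) - 1) \<beta>) \<eta> \<and> closed_form A 1 \<eta>)"

definition exact_eikonal :: "('m, 'n::{finite,linorder}) chart set \<Rightarrow> ('m, 'n) metric_field \<Rightarrow>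
    ('m, 'n) form_field \<Rightarrow> bool" where
  "exact_eikonal A g \<beta> \<longleftrightarrow>
     (\<exists>\<eta>. normalization A g 1 (star g (CARD('n) - 1) \<beta>) \<eta> \<and> exact_one_form A \<eta>)"

end

theory Submission
  imports Defs
begin

text \<open>Let \<open>n\<close> be the dimension and \<open>m = n - 1\<close>. At a point with an inner product \<open>g\<close>, an \<open>m\<close>-form \<open>\<beta>\<close>
  is the same as a vector \<open>B\<close> with \<open>\<iota>\<^sub>B \<mu> = \<beta>\<close>, and in terms of \<open>B\<close> everything is explicit:
  \<open>\<star>\<beta> = (-1)\<^sup>m g B\<close> (\<open>hodge_contract_volume\<close>), \<open>\<star>(g B) = \<beta>\<close> (\<open>hodge_one_form\<close>), and both forms have
  the norm \<open>\<bar>B\<bar>\<close> (\<open>form_norm_contract_volume\<close>, \<open>form_norm_one_form\<close>). What concerns \<open>\<star>\<beta>\<close> rests on the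
  identity that summing \<open>det (a, e\<^sub>I) det (w, e\<^sub>I)\<close> over all \<open>m\<close>-tuples \<open>e\<^sub>I\<close> of basis vectors gives \<open>m! (a \<bullet> w)\<close>.

  Write \<open>B\<close> for the vector field of \<open>\<beta>\<close> with respect to the first metric, \<open>f = \<bar>B\<bar>\<close> for its norm and
  \<open>\<alpha> = ghat B\<close> for the 1-form dual to it, so that the star of \<open>\<beta>\<close> is \<open>\<plusminus>\<alpha>\<close>. Passing to
  \<open>gbar = f\<^sup>2 ghat\<close> multiplies the volume form by the \<open>n\<close>-th power of \<open>f\<close>. Hence the new vector field
  \<open>Y\<close> is \<open>B\<close> divided by that power, its norm \<open>h\<close> is \<open>f\<close> to the power \<open>2 - n\<close>, and its dual 1-form is
  \<open>gbar Y = h \<alpha>\<close>. So \<open>\<alpha>\<close> is the dual of the \<open>gbar\<close>-unit vector along the field lines of \<open>\<beta>\<close>.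

  The last two equivalences follow at once: as \<open>h\<close> is positive, the star of \<open>\<beta>\<close> with respect to \<open>ghat\<close> is
  the only normalization of the star of \<open>\<beta>\<close> with respect to \<open>gbar\<close> (\<open>normalization_bar_iff\<close>), and
  \<open>\<beta>\<close> being harmonic, or exact harmonic, says exactly that this 1-form is closed, or exact.

  The first equivalence is the computation \<open>gbar (\<nabla>\<^sub>Y Y) = \<iota>\<^sub>Y d(h \<alpha>) + d(h\<^sup>2) / 2\<close>, which for
  \<open>\<alpha>(Y) = h\<close> simplifies to \<open>h \<iota>\<^sub>Y d\<alpha> + Y(h) \<alpha>\<close> (\<open>levi_civita_lowered\<close>). The first summand vanishes on
  \<open>Y\<close> and the second is a multiple of \<open>gbar Y\<close>, so \<open>\<nabla>\<^sub>Y Y = r Y\<close> holds if and only if \<open>\<iota>\<^sub>Y d\<alpha> = 0\<close> and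
  \<open>r = Y(h) / h\<close> (\<open>levi_civita_parallel_iff\<close>). As \<open>Y\<close> is a positive multiple of \<open>B\<close>, the condition on
  \<open>d\<alpha>\<close> is force-freeness, and \<open>Y(h) / h\<close> is a smooth function on the manifold, because \<open>Y\<close> and \<open>h\<close> do
  not depend on the chart (\<open>ex_global_rate\<close>).\<close>

section \<open>Closure properties of smooth functions\<close>

lemma Ck_on_subset: "Ck_on k U f \<Longrightarrow> V \<subseteq> U \<Longrightarrow> Ck_on k V f"
proof (induction k arbitrary: f)
  case 0
  then show ?case by (auto intro: continuous_on_subset)
next
  case (Suc k)
  then show ?case by auto
qed

lemma Ck_on_cong:
  assumes "open U" "\<And>x. x \<in> U \<Longrightarrow> f x = g x" "Ck_on k U f"
  shows "Ck_on k U g"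
  using assms(2,3)
proof (induction k arbitrary: f g)
  case 0
  then show ?case using continuous_on_cong[of U U f g] by simp
next
  case (Suc k)
  have D: "f differentiable (at x)" if "x \<in> U" for x using Suc.prems that by auto
  have "g differentiable (at x)" if "x \<in> U" for x
    using D[OF that] that Suc.prems(1) \<open>open U\<close>
    by (meson differentiable_def has_derivative_transform_within_open)
  moreover have "Ck_on k U (\<lambda>x. frechet_derivative g (at x) v)" for v
  proof (rule Suc.IH)
    show "Ck_on k U (\<lambda>x. frechet_derivative f (at x) v)" using Suc.prems(2) by auto
    show "frechet_derivative f (at x) v = frechet_derivative g (at x) v" if "x \<in> U" for x
      using frechet_derivative_transform_within_open[OF D[OF that] \<open>open U\<close> that, of g] Suc.prems(1)
      by simp
  qed
  ultimately show ?case by simp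
qed

text \<open>Any explicit formula for the derivative on an open set may replace the one chosen by
  \<open>frechet_derivative\<close>.\<close>

lemma Ck_on_derivI:
  assumes "open U" "\<And>x. x \<in> U \<Longrightarrow> (f has_derivative f' x) (at x)"
    and "\<And>v. Ck_on k U (\<lambda>x. f' x v)"
  shows "Ck_on (Suc k) U f"
proof -
  have "frechet_derivative f (at x) = f' x" if "x \<in> U" for x
    using frechet_derivative_at[OF assms(2)[OF that]] by simp
  then have "Ck_on k U (\<lambda>x. frechet_derivative f (at x) v)" for v
    by (intro Ck_on_cong[OF \<open>open U\<close> _ assms(3)[of v]]) simp
  then show ?thesis using assms(2) by (auto simp: differentiable_def)
qed

lemma Ck_on_SucD: "Ck_on (Suc k) U f \<Longrightarrow> Ck_on k U f"
proof (induction k arbitrary: f)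
  case 0
  then have "f differentiable_on U"
    by (simp add: differentiable_on_def differentiable_at_withinI)
  then show ?case by (simp add: differentiable_imp_continuous_on)
next
  case (Suc k)
  then show ?case by auto
qed

lemma Ck_on_const: "Ck_on k U (\<lambda>x. c)"
  by (induction k arbitrary: c) auto

lemma Ck_on_add:
  assumes "open U" "Ck_on k U f" "Ck_on k U g"
  shows "Ck_on k U (\<lambda>x. f x + g x)"
  using assms(2,3)
proof (induction k arbitrary: f g)
  case 0
  then show ?case by (auto intro: continuous_on_add)
next
  case (Suc k)
  show ?case
  proof (rule Ck_on_derivI[OF \<open>open U\<close>])
    show "((\<lambda>x. f x + g x) has_derivative
        (\<lambda>v. frechet_derivative f (at x) v + frechet_derivative g (at x) v)) (at x)" if "x \<in> U" for x
      using Suc.prems that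
      by (intro has_derivative_add frechet_derivative_works[THEN iffD1]) auto
  qed (use Suc in auto)
qed

lemma Ck_on_mult:
  fixes f g :: "'a::euclidean_space \<Rightarrow> real"
  assumes "open U" "Ck_on k U f" "Ck_on k U g"
  shows "Ck_on k U (\<lambda>x. f x * g x)"
  using assms(2,3)
proof (induction k arbitrary: f g)
  case 0
  then show ?case by (auto intro: continuous_on_mult)
next
  case (Suc k)
  show ?case
  proof (rule Ck_on_derivI[OF \<open>open U\<close>])
    show "((\<lambda>x. f x * g x) has_derivative
        (\<lambda>v. f x * frechet_derivative g (at x) v + frechet_derivative f (at x) v * g x)) (at x)"
      if "x \<in> U" for x
      using Suc.prems that
      by (intro has_derivative_mult frechet_derivative_works[THEN iffD1]) auto
    show "Ck_on k U (\<lambda>x. f x * frechet_derivative g (at x) v + frechet_derivative f (at x) v * g x)" for v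
      using Suc.prems Ck_on_SucD[OF Suc.prems(1)] Ck_on_SucD[OF Suc.prems(2)]
      by (intro Ck_on_add[OF \<open>open U\<close>] Suc.IH) auto
  qed
qed

lemma Ck_on_bounded_linear:
  assumes "open U" "bounded_linear L" "Ck_on k U f"
  shows "Ck_on k U (\<lambda>x. L (f x))"
  using assms(3)
proof (induction k arbitrary: f)
  case 0
  then show ?case using assms(2)
    by (auto intro: bounded_linear.continuous_on)
next
  case (Suc k)
  show ?case
  proof (rule Ck_on_derivI[OF \<open>open U\<close>])
    show "((\<lambda>x. L (f x)) has_derivative (\<lambda>v. L (frechet_derivative f (at x) v))) (at x)"
      if "x \<in> U" for x
      using Suc.prems that
      by (intro bounded_linear.has_derivative[OF assms(2)] frechet_derivative_works[THEN iffD1]) auto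
  qed (use Suc in auto)
qed

text \<open>Arbitrary real exponents make the induction close, as the derivative of a power contains the
  next lower power. Reciprocals and square roots of positive functions are special cases.\<close>

lemma Ck_on_powr:
  fixes f :: "'a::euclidean_space \<Rightarrow> real"
  assumes "open U" "\<And>x. x \<in> U \<Longrightarrow> 0 < f x" "Ck_on k U f"
  shows "Ck_on k U (\<lambda>x. f x powr p)"
  using assms(3)
proof (induction k arbitrary: p)
  case 0
  then show ?case using assms(2) by (force intro!: continuous_on_powr)
next
  case (Suc k)
  show ?case
  proof (rule Ck_on_derivI[OF \<open>open U\<close>])
    show "((\<lambda>x. f x powr p) has_derivative
        (\<lambda>v. p * (f x powr (p - 1) * frechet_derivative f (at x) v))) (at x)" if "x \<in> U" for x
    proof -
      have "(f has_derivative frechet_derivative f (at x)) (at x)"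
        using Suc.prems that by (intro frechet_derivative_works[THEN iffD1]) auto
      from has_derivative_powr[OF this has_derivative_const[of p], of ] assms(2)[OF that]
      show ?thesis by (auto elim!: has_derivative_eq_rhs simp: powr_diff field_simps)
    qed
    show "Ck_on k U (\<lambda>x. p * (f x powr (p - 1) * frechet_derivative f (at x) v))" for v
      using Suc.prems Ck_on_SucD[OF Suc.prems]
      by (intro Ck_on_mult[OF \<open>open U\<close>] Ck_on_const Suc.IH) auto
  qed
qed

lemma smooth_on_cong:
  assumes "smooth_on S f" "\<And>x. x \<in> S \<Longrightarrow> f x = g x"
  shows "smooth_on S g"
  unfolding smooth_on_def
proof
  fix x assume "x \<in> S"
  then obtain U F where "open U" "x \<in> U" "\<forall>k. Ck_on k U F" "\<forall>y\<in>S \<inter> U. f y = F y"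
    using assms(1) unfolding smooth_on_def by blast
  then show "\<exists>U F. open U \<and> x \<in> U \<and> (\<forall>k. Ck_on k U F) \<and> (\<forall>y\<in>S \<inter> U. g y = F y)"
    using assms(2) by (intro exI[of _ U] exI[of _ F]) auto
qed

lemma smooth_onE:
  assumes "smooth_on S f" "x \<in> S"
  obtains U F where "open U" "x \<in> U" "\<And>k. Ck_on k U F" "\<And>y. y \<in> S \<Longrightarrow> y \<in> U \<Longrightarrow> f y = F y"
proof -
  from assms obtain U F where "open U" "x \<in> U" "\<forall>k. Ck_on k U F" "\<forall>y\<in>S \<inter> U. f y = F y"
    unfolding smooth_on_def by blast
  then show thesis by (intro that[of U F]) auto
qed

lemma smooth_on_const: "smooth_on S (\<lambda>x. c)"
  unfolding smooth_on_def
  by (intro ballI exI[of _ UNIV] exI[of _ "\<lambda>x. c"] conjI allI Ck_on_const) auto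

text \<open>Smoothness on a set is witnessed by local extensions; two of them are combined on the
  intersection of their domains.\<close>

lemma smooth_on_binop:
  fixes f :: "'a::euclidean_space \<Rightarrow> 'b::real_normed_vector"
    and g :: "'a \<Rightarrow> 'c::real_normed_vector"
    and b :: "'b \<Rightarrow> 'c \<Rightarrow> 'd::real_normed_vector"
  assumes "smooth_on S f" "smooth_on S g"
    and op: "\<And>(U :: 'a set) k F G. open U \<Longrightarrow> Ck_on k U F \<Longrightarrow> Ck_on k U G \<Longrightarrow> Ck_on k U (\<lambda>x. b (F x) (G x))"
  shows "smooth_on S (\<lambda>x. b (f x) (g x))"
  unfolding smooth_on_def
proof
  fix x assume x: "x \<in> S"
  obtain U F where U: "open U" "x \<in> U" "\<And>k. Ck_on k U F" "\<And>y. y \<in> S \<Longrightarrow> y \<in> U \<Longrightarrow> f y = F y"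
    using smooth_onE[OF assms(1) x] by blast
  obtain V G where V: "open V" "x \<in> V" "\<And>k. Ck_on k V G" "\<And>y. y \<in> S \<Longrightarrow> y \<in> V \<Longrightarrow> g y = G y"
    using smooth_onE[OF assms(2) x] by blast
  have "Ck_on k (U \<inter> V) (\<lambda>x. b (F x) (G x))" for k
    using U(1) V(1) by (intro op Ck_on_subset[OF U(3)] Ck_on_subset[OF V(3)]) auto
  then show "\<exists>U F. open U \<and> x \<in> U \<and> (\<forall>k. Ck_on k U F) \<and> (\<forall>y\<in>S \<inter> U. b (f y) (g y) = F y)"
    using U V by (intro exI[of _ "U \<inter> V"] exI[of _ "\<lambda>x. b (F x) (G x)"]) auto
qed

lemma smooth_on_add: "smooth_on S f \<Longrightarrow> smooth_on S g \<Longrightarrow> smooth_on S (\<lambda>x. f x + g x)"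
  by (rule smooth_on_binop) (auto intro: Ck_on_add)

lemma smooth_on_mult:
  fixes f g :: "'a::euclidean_space \<Rightarrow> real"
  shows "smooth_on S f \<Longrightarrow> smooth_on S g \<Longrightarrow> smooth_on S (\<lambda>x. f x * g x)"
  by (rule smooth_on_binop) (auto intro: Ck_on_mult)

lemma smooth_on_bounded_linear:
  assumes "bounded_linear L" "smooth_on S f"
  shows "smooth_on S (\<lambda>x. L (f x))"
  using smooth_on_binop[OF assms(2) assms(2), of "\<lambda>a _. L a"] Ck_on_bounded_linear assms(1) by blast

lemma smooth_on_sum:
  fixes f :: "'i \<Rightarrow> 'a::euclidean_space \<Rightarrow> real"
  shows "(\<And>i. i \<in> I \<Longrightarrow> smooth_on S (f i)) \<Longrightarrow> smooth_on S (\<lambda>x. \<Sum>i\<in>I. f i x)"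
  by (induction I rule: infinite_finite_induct) (auto intro: smooth_on_const smooth_on_add)

lemma smooth_on_prod:
  fixes f :: "'i \<Rightarrow> 'a::euclidean_space \<Rightarrow> real"
  shows "(\<And>i. i \<in> I \<Longrightarrow> smooth_on S (f i)) \<Longrightarrow> smooth_on S (\<lambda>x. \<Prod>i\<in>I. f i x)"
  by (induction I rule: infinite_finite_induct) (auto intro: smooth_on_const smooth_on_mult)

lemma smooth_on_powr:
  fixes f :: "'a::euclidean_space \<Rightarrow> real"
  assumes "smooth_on S f" "\<And>x. x \<in> S \<Longrightarrow> 0 < f x"
  shows "smooth_on S (\<lambda>x. f x powr p)"
  unfolding smooth_on_def
proof
  fix x assume x: "x \<in> S"
  obtain U F where U: "open U" "x \<in> U" "\<And>k. Ck_on k U F" "\<And>y. y \<in> S \<Longrightarrow> y \<in> U \<Longrightarrow> f y = F y"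
    using smooth_onE[OF assms(1) x] by blast
  define V where "V = U \<inter> F -` {0<..}"
  have "continuous_on U F" using U(3)[of 0] by simp
  then have V: "open V"
    unfolding V_def using U(1) by (rule continuous_open_preimage) simp
  moreover have "x \<in> V" using assms(2)[OF x] U(2) U(4)[OF x U(2)] by (simp add: V_def)
  moreover have "Ck_on k V (\<lambda>x. F x powr p)" for k
    by (intro Ck_on_powr V Ck_on_subset[OF U(3)]) (simp_all add: V_def)
  moreover have "f y powr p = F y powr p" if "y \<in> S \<inter> V" for y
    using that U(4)[of y] by (simp add: V_def)
  ultimately show "\<exists>U F. open U \<and> x \<in> U \<and> (\<forall>k. Ck_on k U F) \<and> (\<forall>y\<in>S \<inter> U. f y powr p = F y)"
    by (intro exI[of _ V] exI[of _ "\<lambda>x. F x powr p"]) simp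
qed

lemma smooth_on_vec_nth: "smooth_on S f \<Longrightarrow> smooth_on S (\<lambda>x. f x $ i)"
  by (rule smooth_on_bounded_linear[OF bounded_linear_vec_nth])

lemma smooth_on_det:
  fixes M :: "'a::euclidean_space \<Rightarrow> real ^ 'n::finite ^ 'n"
  assumes "smooth_on S M"
  shows "smooth_on S (\<lambda>x. det (M x))"
  unfolding det_def
  by (intro smooth_on_sum smooth_on_mult smooth_on_prod smooth_on_const smooth_on_vec_nth assms)

lemma smooth_on_differentiable:
  assumes "smooth_on S f" "x \<in> S"
  shows "f differentiable (at x within S)"
proof -
  obtain U F where U: "open U" "x \<in> U" "\<And>k. Ck_on k U F" "\<And>y. y \<in> S \<Longrightarrow> y \<in> U \<Longrightarrow> f y = F y"
    using smooth_onE[OF assms] by blast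
  have "F differentiable (at x)" using U(3)[of 1] U(2) by simp
  then have "F differentiable (at x within S)" by (rule differentiable_at_withinI)
  moreover obtain e where "0 < e" "ball x e \<subseteq> U" using U by (meson open_contains_ball)
  ultimately show ?thesis
    by (intro differentiable_transform_within[of F x S e f])
      (use U(4) assms(2) in \<open>auto simp: dist_commute subset_iff\<close>)
qed

section \<open>Uniqueness of derivatives on the half-space\<close>

text \<open>A relatively open subset of the half-space contains, from each of its points, a short segment
  in the positive direction of every coordinate; that pins down the value of a derivative on every
  basis vector, also at boundary points.\<close>

lemma half_space_has_derivative_unique:
  fixes S :: "(real ^ 'n::{finite,linorder}) set"
  assumes "openin (top_of_set half_space) S" "x \<in> S"
    and "(f has_derivative f') (at x within S)" "(f has_derivative f'') (at x within S)"
  shows "f' = f''"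
proof (rule frechet_derivative_unique_within[OF assms(3,4)])
  fix i and e :: real
  assume i: "i \<in> (Basis :: (real, 'n) vec set)" and e: "0 < e"
  obtain d where d: "0 < d" "ball x d \<inter> half_space \<subseteq> S"
    using assms(1,2) unfolding openin_contains_ball by blast
  (* positive, since the half-space is only guaranteed to continue in positive directions *)
  define t where "t = min d e / 2"
  have "x \<in> half_space" using assms(1,2) openin_imp_subset by blast
  moreover have "0 \<le> i $ Max UNIV" using i by (auto simp: Basis_vec_def axis_def)
  ultimately have "x + t *\<^sub>R i \<in> half_space" using d e by (simp add: half_space_def t_def)
  moreover have "x + t *\<^sub>R i \<in> ball x d" using i d e by (simp add: dist_norm t_def)
  ultimately show "\<exists>d. 0 < \<bar>d\<bar> \<and> \<bar>d\<bar> < e \<and> x + d *\<^sub>R i \<in> S"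
    using d e by (intro exI[of _ t]) (auto simp: t_def)
qed

lemma half_space_frechet_derivativeI:
  fixes S :: "(real ^ 'n::{finite,linorder}) set"
  assumes "openin (top_of_set half_space) S" "x \<in> S" "(f has_derivative f') (at x within S)"
  shows "frechet_derivative f (at x within S) = f'"
  using half_space_has_derivative_unique[OF assms(1,2)] assms(3)
    frechet_derivative_works differentiableI by metis

text \<open>The derivative within the set is, near each point, the restriction of the derivative of
  a local smooth extension, because derivatives within the set are unique.\<close>

lemma smooth_on_frechet_derivative:
  fixes S :: "(real ^ 'n::{finite,linorder}) set"
  assumes S: "openin (top_of_set half_space) S" and f: "smooth_on S f"
  shows "smooth_on S (\<lambda>x. frechet_derivative f (at x within S) v)"
  unfolding smooth_on_def
proof
  fix x assume x: "x \<in> S"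
  obtain U F where U: "open U" "x \<in> U" "\<And>k. Ck_on k U F" "\<And>y. y \<in> S \<Longrightarrow> y \<in> U \<Longrightarrow> f y = F y"
    using smooth_onE[OF f x] by blast
  have "frechet_derivative f (at y within S) v = frechet_derivative F (at y) v"
    if y: "y \<in> S" "y \<in> U" for y
  proof -
    have "F differentiable (at y)" using U(3)[of 1] y by simp
    then have "(F has_derivative frechet_derivative F (at y)) (at y within S)"
      by (rule has_derivative_at_withinI[OF frechet_derivative_works[THEN iffD1]])
    moreover obtain e where "0 < e" "ball y e \<subseteq> U" using U y by (meson open_contains_ball)
    ultimately have "(f has_derivative frechet_derivative F (at y)) (at y within S)"
      by (intro has_derivative_transform_within[of F _ y S e f])
        (use U(4) y in \<open>auto simp: dist_commute subset_iff\<close>)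
    then have "frechet_derivative f (at y within S) = frechet_derivative F (at y)"
      by (rule half_space_frechet_derivativeI[OF S y(1)])
    then show ?thesis by simp
  qed
  moreover have "Ck_on k U (\<lambda>x. frechet_derivative F (at x) v)" for k
    using U(3)[of "Suc k"] by simp
  ultimately show "\<exists>U F. open U \<and> x \<in> U \<and> (\<forall>k. Ck_on k U F) \<and>
      (\<forall>y\<in>S \<inter> U. frechet_derivative f (at y within S) v = F y)"
    using U by (intro exI[of _ U] exI[of _ "\<lambda>x. frechet_derivative F (at x) v"]) auto
qed

section \<open>Alternating forms\<close>

lemma alternating_form_cong:
  assumes "alternating_form UNIV k \<omega>" "\<And>i. i < k \<Longrightarrow> v i = w i"
  shows "\<omega> v = \<omega> w"
  using assms unfolding alternating_form_def by auto

lemma alternating_form_linear: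
  assumes "alternating_form UNIV k \<omega>" "i < k"
  shows "linear (\<lambda>x. \<omega> (v(i := x)))"
proof -
  have *: "\<omega> (v(i := a *\<^sub>R x + b *\<^sub>R y)) = a * \<omega> (v(i := x)) + b * \<omega> (v(i := y))" for x y a b
    using assms unfolding alternating_form_def by auto
  show ?thesis
    by (rule linearI) (use *[of 1 _ 1] *[of _ _ 0] in simp_all)
qed

lemma alternating_form_repeated:
  assumes "alternating_form UNIV k \<omega>" "i < k" "j < k" "i \<noteq> j" "v i = v j"
  shows "\<omega> v = 0"
  using assms unfolding alternating_form_def by blast

lemma alternating_formI:
  assumes "\<And>v w. (\<And>i. i < k \<Longrightarrow> v i = w i) \<Longrightarrow> \<omega> v = \<omega> w"
    and "\<And>v i. i < k \<Longrightarrow> linear (\<lambda>x. \<omega> (v(i := x)))"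
    and "\<And>v i j. i < k \<Longrightarrow> j < k \<Longrightarrow> i \<noteq> j \<Longrightarrow> v i = v j \<Longrightarrow> \<omega> v = 0"
  shows "alternating_form UNIV k \<omega>"
  unfolding alternating_form_def
proof (intro conjI allI impI ballI)
  fix v :: "nat \<Rightarrow> real ^ 'a" and i x y and a b :: real assume i: "i < k"
  interpret linear "\<lambda>x. \<omega> (v(i := x))" by (rule assms(2)[OF i])
  show "\<omega> (v(i := a *\<^sub>R x + b *\<^sub>R y)) = a * \<omega> (v(i := x)) + b * \<omega> (v(i := y))"
    by (simp add: add scale)
next
  fix v :: "nat \<Rightarrow> real ^ 'a" and i j assume "i < k" "j < k" "i \<noteq> j \<and> v i = v j"
  then show "\<omega> v = 0" using assms(3)[of i j v] by blast
qed (use assms(1) in blast)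

text \<open>Polarization of \<open>\<omega>(\<dots>, x + y, \<dots>, x + y, \<dots>) = 0\<close>.\<close>

lemma alternating_form_swap:
  assumes \<omega>: "alternating_form UNIV k \<omega>" and ij: "i < k" "j < k" "i \<noteq> j"
  shows "\<omega> (\<lambda>l. v (Transposition.transpose i j l)) = - \<omega> v"
proof -
  define F where "F x y = \<omega> (v(i := x, j := y))" for x y
  have 1: "F (x + x') y = F x y + F x' y" for x x' y
  proof -
    interpret linear "\<lambda>x. \<omega> ((v(j := y))(i := x))" by (rule alternating_form_linear[OF \<omega> ij(1)])
    show ?thesis using add[of x x'] ij by (simp add: F_def fun_upd_twist)
  qed
  have 2: "F x (y + y') = F x y + F x y'" for x y y'
  proof -
    interpret linear "\<lambda>y. \<omega> ((v(i := x))(j := y))" by (rule alternating_form_linear[OF \<omega> ij(2)])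
    show ?thesis using add[of y y'] by (simp add: F_def)
  qed
  have 0: "F x x = 0" for x
    unfolding F_def by (rule alternating_form_repeated[OF \<omega> ij]) (use ij in simp)
  have "F (v i + v j) (v i + v j) = F (v i) (v j) + F (v j) (v i)"
    unfolding 1 2 by (simp add: 0)
  then have "F (v j) (v i) = - F (v i) (v j)" using 0 by simp
  moreover have "F (v i) (v j) = \<omega> v" by (simp add: F_def)
  moreover have "v(i := v j, j := v i) = (\<lambda>l. v (Transposition.transpose i j l))"
    by (auto simp: Transposition.transpose_def)
  ultimately show ?thesis by (simp add: F_def)
qed

lemma alternating_form_permute:
  assumes \<omega>: "alternating_form UNIV k \<omega>" and "\<sigma> permutes {..<k}"
  shows "\<omega> (\<lambda>i. v (\<sigma> i)) = of_int (sign \<sigma>) * \<omega> v"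
  using finite_lessThan[of k] assms(2)
proof (induction rule: permutes_rev_induct)
  case id
  then show ?case by simp
next
  case (swap a b p)
  have "\<omega> (\<lambda>i. v ((p \<circ> Transposition.transpose a b) i)) = - \<omega> (\<lambda>i. v (p i))"
    using alternating_form_swap[OF \<omega>, of a b "\<lambda>i. v (p i)"] swap by simp
  moreover have "sign (p \<circ> Transposition.transpose a b) = - sign p"
    using swap permutation_permutes
    by (subst sign_compose) (auto simp: sign_swap_id permutation_swap_id)
  ultimately show ?case using swap by (simp add: o_def)
qed

text \<open>By multilinearity a form is determined by its values on tuples of basis vectors, and by
  alternation only tuples without repetition matter. The arguments are replaced by basis vectors one at a
  time.\<close>

lemma alternating_form_eqI:
  assumes \<omega>: "alternating_form UNIV k \<omega>" and \<eta>: "alternating_form UNIV k \<eta>"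
    and eq: "\<And>I. inj_on I {..<k} \<Longrightarrow> \<omega> (\<lambda>i. axis (I i) 1) = \<eta> (\<lambda>i. axis (I i) 1)"
  shows "\<omega> = \<eta>"
proof
  have "\<omega> v = \<eta> v" if "m \<le> k" "\<And>i. m \<le> i \<Longrightarrow> v i \<in> range (\<lambda>p. axis p 1)"
    for m and v :: "nat \<Rightarrow> real ^ 'a"
    using that
  proof (induction m arbitrary: v)
    case 0
    then have "\<forall>i. \<exists>p. v i = axis p 1" by auto
    then obtain I where "\<And>i. v i = axis (I i) 1" by metis
    then have v: "v = (\<lambda>i. axis (I i) 1)" by auto
    show ?case
    proof (cases "inj_on I {..<k}")
      case True
      then show ?thesis using eq v by simp
    next
      case False
      then obtain i j where "i < k" "j < k" "i \<noteq> j" "v i = v j" unfolding inj_on_def v by auto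
      then show ?thesis
        using alternating_form_repeated[OF \<omega>, of i j v] alternating_form_repeated[OF \<eta>, of i j v]
        by simp
    qed
  next
    case (Suc m)
    have m: "m < k" using Suc.prems by simp
    have eqm: "\<omega> (v(m := axis p 1)) = \<eta> (v(m := axis p 1))" for p
      by (rule Suc.IH) (use Suc.prems in \<open>auto simp: Suc_le_eq\<close>)
    have expand: "\<xi> v = (\<Sum>p\<in>UNIV. v m $ p * \<xi> (v(m := axis p 1)))"
      if \<xi>: "alternating_form UNIV k \<xi>" for \<xi>
    proof -
      interpret linear "\<lambda>x. \<xi> (v(m := x))" by (rule alternating_form_linear[OF \<xi> m])
      have "\<xi> (v(m := v m)) = \<xi> (v(m := (\<Sum>p\<in>UNIV. v m $ p *\<^sub>R axis p 1)))"
        using basis_expansion[of "v m"] by (simp add: scalar_mult_eq_scaleR)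
      also have "\<dots> = (\<Sum>p\<in>UNIV. v m $ p * \<xi> (v(m := axis p 1)))"
        by (simp only: sum scale real_scaleR_def)
      finally show ?thesis by simp
    qed
    show ?case unfolding expand[OF \<omega>] expand[OF \<eta>] eqm ..
  qed
  from this[of k] have *: "\<omega> v = \<eta> v" if "\<And>i. k \<le> i \<Longrightarrow> v i \<in> range (\<lambda>p. axis p 1)"
    for v :: "nat \<Rightarrow> real ^ 'a"
    using that by simp
  fix v :: "nat \<Rightarrow> real ^ 'a"
  (* arguments beyond the first k do not matter, so they may be taken to be basis vectors *)
  let ?v = "\<lambda>i. if i < k then v i else axis undefined 1"
  have "\<omega> v = \<omega> ?v" by (rule alternating_form_cong[OF \<omega>]) simp
  also have "\<dots> = \<eta> ?v" by (rule *) simp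
  also have "\<dots> = \<eta> v" by (rule alternating_form_cong[OF \<eta>]) simp
  finally show "\<omega> v = \<eta> v" .
qed

lemma case_nat_upd: "case_nat b (v(i := x)) = (case_nat b v)(Suc i := x)"
  by (auto split: nat.split)

lemma alternating_form_contract:
  assumes \<omega>: "alternating_form UNIV (Suc k) \<omega>"
  shows "alternating_form UNIV k (contract b \<omega>)"
proof (rule alternating_formI)
  fix v w :: "nat \<Rightarrow> real ^ 'a" assume "\<And>i. i < k \<Longrightarrow> v i = w i"
  then show "contract b \<omega> v = contract b \<omega> w"
    unfolding contract_def by (intro alternating_form_cong[OF \<omega>]) (auto split: nat.split)
next
  fix v i assume "i < k"
  then show "linear (\<lambda>x. contract b \<omega> (v(i := x)))"
    unfolding contract_def case_nat_upd by (intro alternating_form_linear[OF \<omega>]) simp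
next
  fix v :: "nat \<Rightarrow> real ^ 'a" and i j assume "i < k" "j < k" "i \<noteq> j" "v i = v j"
  then show "contract b \<omega> v = 0"
    unfolding contract_def by (intro alternating_form_repeated[OF \<omega>, of "Suc i" "Suc j"]) auto
qed

section \<open>The determinant as a form\<close>

text \<open>The arguments of a form are numbered and the rows of a matrix are indexed by the type \<open>'n\<close>; row
  \<open>i\<close> of the determinant in the volume form is the argument with this number.\<close>

definition pos :: "'n::{finite,linorder} \<Rightarrow> nat" where
  "pos i = card {j. j < i}"

text \<open>The form \<open>dx\<^sup>1 \<and> \<dots> \<and> dx\<^sup>n\<close>.\<close>

definition coord_vol :: "'n::{finite,linorder} multi_form" where
  "coord_vol v = det (\<chi> i. v (pos i))"

lemma volume_form_eq: "volume_form G v = sqrt (det G) * coord_vol v"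
  by (simp add: volume_form_def coord_vol_def pos_def)

lemma pos_eq_iff [simp]: "pos i = pos j \<longleftrightarrow> i = j"
proof -
  have "pos i < pos j" if "i < j" for i j :: 'a
    unfolding pos_def by (rule psubset_card_mono) (use that in auto)
  then show ?thesis by (metis less_irrefl neqE)
qed

lemma bij_betw_pos: "bij_betw pos (UNIV :: 'n set) {..<CARD('n::{finite,linorder})}"
proof -
  have "pos (i :: 'n) < CARD('n)" for i
    unfolding pos_def by (rule psubset_card_mono) auto
  moreover have inj: "inj (pos :: 'n \<Rightarrow> nat)" by (simp add: inj_def)
  moreover have "card (range (pos :: 'n \<Rightarrow> nat)) = CARD('n)" by (simp add: card_image inj)
  ultimately have "range (pos :: 'n \<Rightarrow> nat) = {..<CARD('n)}"
    by (intro card_subset_eq) auto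
  then show ?thesis using inj by (simp add: bij_betw_def)
qed

lemma pos_less: "pos (i :: 'n::{finite,linorder}) < CARD('n)"
  using bij_betw_pos by (auto simp: bij_betw_def)

lemma ex_pos: "k < CARD('n) \<Longrightarrow> \<exists>i :: 'n::{finite,linorder}. pos i = k"
  by (metis bij_betw_imp_surj_on bij_betw_pos imageE lessThan_iff)

lemma alternating_form_coord_vol:
  "alternating_form UNIV CARD('n) (coord_vol :: 'n::{finite,linorder} multi_form)"
proof (rule alternating_formI)
  fix v w :: "nat \<Rightarrow> (real, 'n) vec" assume "\<And>i. i < CARD('n) \<Longrightarrow> v i = w i"
  then show "coord_vol v = coord_vol w" by (simp add: coord_vol_def pos_less)
next
  fix v :: "nat \<Rightarrow> (real, 'n) vec" and i assume "i < CARD('n)"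
  then obtain k :: 'n where k: "pos k = i" using ex_pos by blast
  have "coord_vol (v(i := x)) = det (\<chi> l. if l = k then x else v (pos l))" for x
    unfolding coord_vol_def k[symmetric] by (simp add: if_distrib cong: if_cong)
  then show "linear (\<lambda>x. coord_vol (v(i := x)))"
    using det_row_add[of k "\<lambda>_. _" "\<lambda>_. _" "\<lambda>l. v (pos l)"]
      det_row_mul[of k _ "\<lambda>_. _" "\<lambda>l. v (pos l)"]
    by (intro linearI) (simp_all flip: scalar_mult_eq_scaleR)
next
  fix v :: "nat \<Rightarrow> (real, 'n) vec" and i j
  assume "i < CARD('n)" "j < CARD('n)" "i \<noteq> j" "v i = v j"
  moreover from this obtain k l :: 'n where "pos k = i" "pos l = j" using ex_pos by metis
  ultimately show "coord_vol v = 0"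
    unfolding coord_vol_def by (intro det_identical_rows[of k l]) (auto simp: row_def)
qed

lemma alternating_form_volume:
  "alternating_form UNIV CARD('n) (volume_form G :: 'n::{finite,linorder} multi_form)"
proof -
  note D = alternating_form_coord_vol[where 'n = 'n]
  show ?thesis
  proof (rule alternating_formI)
    fix v :: "nat \<Rightarrow> (real, 'n) vec" and i assume "i < CARD('n)"
    then show "linear (\<lambda>x. volume_form G (v(i := x)))"
      unfolding volume_form_eq
      using linear_compose_scale_right[OF alternating_form_linear[OF D]] by simp
  qed (auto simp: volume_form_eq intro: alternating_form_cong[OF D] alternating_form_repeated[OF D])
qed

lemma coord_vol_linear_image:
  fixes M :: "'n::{finite,linorder} matrix"
  shows "coord_vol (\<lambda>i. M *v v i) = det M * coord_vol v"
proof -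
  have "(\<chi> i :: 'n. M *v v (pos i)) = (\<chi> i. v (pos i)) ** transpose M"
    by (simp add: vec_eq_iff matrix_matrix_mult_def matrix_vector_mult_def transpose_def mult.commute)
  then show ?thesis by (simp add: coord_vol_def det_mul mult.commute)
qed

text \<open>An enumeration of the indices makes the matrix of arguments a permutation matrix, whose
  determinant is a sign.\<close>

lemma coord_vol_axis_squared:
  fixes I :: "nat \<Rightarrow> 'n::{finite,linorder}"
  assumes "inj_on I {..<CARD('n)}"
  shows "coord_vol (\<lambda>i. axis (I i) 1) * coord_vol (\<lambda>i. axis (I i) 1) = 1"
proof -
  let ?pos = "pos :: 'n \<Rightarrow> nat"
  have "inj (I \<circ> ?pos)"
    using assms bij_betw_pos[where 'n = 'n] by (intro comp_inj_on) (auto simp: bij_betw_def)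
  then have "(I \<circ> ?pos) permutes UNIV"
    using finite_UNIV_inj_surj[of "I \<circ> ?pos"] by (intro bij_imp_permutes) (simp_all add: bij_def)
  from det_permute_rows[OF this, of "mat 1 :: 'n matrix"]
  have "det (\<chi> i. mat 1 $ (I \<circ> ?pos) i) = (of_int (sign (I \<circ> ?pos)) :: real)" by simp
  moreover have "(\<chi> i. mat 1 $ (I \<circ> ?pos) i) = (\<chi> i. axis (I (?pos i)) (1 :: real))"
    by (auto simp: vec_eq_iff mat_def axis_def)
  ultimately have "coord_vol (\<lambda>i. axis (I i) 1) = of_int (sign (I \<circ> ?pos))"
    by (simp add: coord_vol_def)
  then show ?thesis by (simp flip: of_int_mult)
qed

section \<open>Every (n - 1)-form is the contraction of the volume form with a vector\<close>

lemma case_nat_fun_upd_0: "case_nat b v = (case_nat c v)(0 := b)"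
  by (auto split: nat.split)

lemma linear_contract:
  assumes "alternating_form UNIV (Suc k) \<omega>"
  shows "linear (\<lambda>b. contract b \<omega> v)"
  unfolding contract_def
  using alternating_form_linear[OF assms, of 0 "case_nat 0 v"] by (simp flip: case_nat_fun_upd_0)

lemma contract_expand:
  assumes "alternating_form UNIV (Suc k) \<omega>"
  shows "contract b \<omega> v = (\<Sum>p\<in>UNIV. b $ p * contract (axis p 1) \<omega> v)"
proof -
  interpret linear "\<lambda>b. contract b \<omega> v" by (rule linear_contract[OF assms])
  have "contract b \<omega> v = contract (\<Sum>p\<in>UNIV. b $ p *\<^sub>R axis p 1) \<omega> v"
    using basis_expansion[of b] by (simp add: scalar_mult_eq_scaleR)
  also have "\<dots> = (\<Sum>p\<in>UNIV. b $ p * contract (axis p 1) \<omega> v)"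
    by (simp only: sum scale real_scaleR_def)
  finally show ?thesis .
qed

lemma case_nat_axis: "case_nat (axis p 1) (\<lambda>i. axis (I i) 1) = (\<lambda>i. axis (case_nat p I i) 1)"
  by (auto split: nat.split)

lemma inj_on_case_nat:
  "inj_on (case_nat p I) {..<Suc m} \<longleftrightarrow> inj_on I {..<m} \<and> p \<notin> I ` {..<m}"
proof -
  have "inj_on (case_nat p I) (Suc ` {..<m}) \<longleftrightarrow> inj_on I {..<m}"
    by (auto simp: inj_on_def)
  moreover have "case_nat p I ` (Suc ` {..<m}) = I ` {..<m}" by (simp add: image_image)
  moreover have "Suc ` {..<m} - {0} = Suc ` {..<m}" by auto
  ultimately show ?thesis by (simp add: lessThan_Suc_eq_insert_0 inj_on_insert)
qed

lemma image_missing_one: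
  fixes I :: "nat \<Rightarrow> 'n::finite"
  assumes "CARD('n) = Suc m" "inj_on I {..<m}" "p \<notin> I ` {..<m}"
  shows "I ` {..<m} = UNIV - {p}"
proof (rule card_subset_eq)
  show "card (I ` {..<m}) = card (UNIV - {p})" using assms by (simp add: card_image)
qed (use assms in auto)

lemma card_enumerations_missing_one:
  fixes p :: "'n::finite"
  assumes n: "CARD('n) = Suc m"
  shows "card {I \<in> {..<m} \<rightarrow>\<^sub>E UNIV. inj_on I {..<m} \<and> p \<notin> I ` {..<m}} = fact m"
proof -
  have "{I \<in> {..<m} \<rightarrow>\<^sub>E UNIV. inj_on I {..<m} \<and> p \<notin> I ` {..<m}} =
      {I \<in> {..<m} \<rightarrow>\<^sub>E (UNIV - {p}). inj_on I {..<m}}"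
    by (auto simp: PiE_iff)
  moreover have "card (UNIV - {p}) = m" using n by simp
  ultimately show ?thesis
    using card_inj_on_subset_funcset[of "{..<m}" "UNIV - {p}" "{..<m}"]
    by (simp add: fact_prod_rev)
qed

text \<open>The determinant of \<open>(e\<^sub>p, e\<^sub>I)\<close> is nonzero only if \<open>I\<close> enumerates the indices other than
  \<open>p\<close>. For \<open>p \<noteq> q\<close> no tuple does this for both, and for \<open>p = q\<close> each of the \<open>m!\<close> enumerations
  contributes the square of a sign.\<close>

lemma sum_coord_vol_axis:
  fixes p q :: "'n::{finite,linorder}"
  assumes n: "CARD('n) = Suc m"
  shows "(\<Sum>I\<in>{..<m} \<rightarrow>\<^sub>E UNIV. contract (axis p 1) coord_vol (\<lambda>i. axis (I i) 1) *
      contract (axis q 1) coord_vol (\<lambda>i. axis (I i) 1)) = (if p = q then fact m else 0)"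
    (is "(\<Sum>I\<in>?E. ?D p I * ?D q I) = _")
proof -
  note D = alternating_form_coord_vol[where 'n = 'n, unfolded n]
  have zero: "?D p I = 0" if "\<not> (inj_on I {..<m} \<and> p \<notin> I ` {..<m})" for p I
  proof -
    have "\<not> inj_on (case_nat p I) {..<Suc m}" using that inj_on_case_nat[of p I m] by blast
    then obtain i j where "i < Suc m" "j < Suc m" "i \<noteq> j" "case_nat p I i = case_nat p I j"
      unfolding inj_on_def by blast
    then show ?thesis
      unfolding contract_def case_nat_axis
      by (intro alternating_form_repeated[OF D, of i j]) auto
  qed
  have one: "?D p I * ?D p I = 1" if "inj_on I {..<m} \<and> p \<notin> I ` {..<m}" for p I
    using that coord_vol_axis_squared[of "case_nat p I"]
    unfolding contract_def case_nat_axis n inj_on_case_nat by simp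
  show ?thesis
  proof (cases "p = q")
    case True
    have "(\<Sum>I\<in>?E. ?D p I * ?D p I) =
        (\<Sum>I\<in>?E. if inj_on I {..<m} \<and> p \<notin> I ` {..<m} then 1 else 0)"
      by (intro sum.cong refl) (use one zero in auto)
    also have "\<dots> = card {I \<in> ?E. inj_on I {..<m} \<and> p \<notin> I ` {..<m}}"
      by (simp add: sum.If_cases finite_PiE Int_def)
    finally show ?thesis using card_enumerations_missing_one[OF n, of p] True by simp
  next
    case False
    have "?D p I * ?D q I = 0" for I
      using zero[of I p] zero[of I q] image_missing_one[OF n, of I p] False by auto
    then have "(\<Sum>I\<in>?E. ?D p I * ?D q I) = 0" by (intro sum.neutral ballI)
    then show ?thesis using False by simp
  qed
qed

text \<open>The (n - 1)-forms \<open>\<iota>\<^sub>a det\<close> recover the inner product of the vectors \<open>a\<close>. In particular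
  \<open>a\<close> is determined by its form, and this sum is what the Hodge star of an (n - 1)-form amounts to.\<close>

lemma sum_contract_coord_vol:
  fixes a w :: "(real, 'n::{finite,linorder}) vec"
  assumes n: "CARD('n) = Suc m"
  shows "(\<Sum>I\<in>{..<m} \<rightarrow>\<^sub>E UNIV. contract a coord_vol (\<lambda>i. axis (I i) 1) *
      contract w coord_vol (\<lambda>i. axis (I i) 1)) = fact m * (a \<bullet> w)"
    (is "(\<Sum>I\<in>?E. _) = _")
proof -
  note D = alternating_form_coord_vol[where 'n = 'n, unfolded n]
  let ?D = "\<lambda>p I. contract (axis p 1) coord_vol (\<lambda>i. axis (I i) 1)"
  have "(\<Sum>I\<in>?E. contract a coord_vol (\<lambda>i. axis (I i) 1) * contract w coord_vol (\<lambda>i. axis (I i) 1))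
      = (\<Sum>I\<in>?E. \<Sum>p\<in>UNIV. \<Sum>q\<in>UNIV. a $ p * w $ q * (?D p I * ?D q I))"
    unfolding contract_expand[OF D, of a] contract_expand[OF D, of w]
    by (simp add: sum_product mult_ac)
  also have "\<dots> = (\<Sum>p\<in>UNIV. \<Sum>q\<in>UNIV. a $ p * w $ q * (\<Sum>I\<in>?E. ?D p I * ?D q I))"
    by (simp add: sum.swap[of _ ?E] sum_distrib_left)
  also have "\<dots> = (\<Sum>p\<in>UNIV. \<Sum>q\<in>UNIV. if p = q then a $ p * w $ q * fact m else 0)"
    unfolding sum_coord_vol_axis[OF n] by (intro sum.cong refl) auto
  also have "\<dots> = fact m * (a \<bullet> w)"
    by (simp add: inner_vec_def sum_distrib_left mult_ac)
  finally show ?thesis .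
qed

lemma contract_coord_vol_inject:
  fixes a b :: "(real, 'n::{finite,linorder}) vec"
  assumes "contract a coord_vol = contract b coord_vol"
  shows "a = b"
proof -
  obtain m where n: "CARD('n) = Suc m" by (metis not0_implies_Suc zero_less_card_finite less_irrefl)
  have "fact m * (a \<bullet> w) = fact m * (b \<bullet> w)" for w
    unfolding sum_contract_coord_vol[OF n, symmetric] assms ..
  then show ?thesis by (intro vector_eq_rdot[THEN iffD1]) simp
qed

text \<open>A fixed enumeration of the indices other than \<open>p\<close>. Its dependence on \<open>p\<close> alone, and not
  on a form, keeps the components of \<open>form_vec\<close> below smooth in the form.\<close>

definition enum_missing :: "'n::finite \<Rightarrow> nat \<Rightarrow> 'n" where
  "enum_missing p = (SOME I. inj_on I {..<CARD('n) - 1} \<and> p \<notin> I ` {..<CARD('n) - 1})"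

lemma enum_missing:
  fixes p :: "'n::finite"
  assumes n: "CARD('n) = Suc m"
  shows "inj_on (enum_missing p) {..<m}" "p \<notin> enum_missing p ` {..<m}"
proof -
  have "card {I \<in> {..<m} \<rightarrow>\<^sub>E UNIV. inj_on I {..<m} \<and> p \<notin> I ` {..<m}} \<noteq> 0"
    unfolding card_enumerations_missing_one[OF n] by simp
  then obtain I where "inj_on I {..<m} \<and> p \<notin> I ` {..<m}"
    by (metis (mono_tags, lifting) card.empty equals0I mem_Collect_eq)
  from someI[where P = "\<lambda>I. inj_on I {..<m} \<and> p \<notin> I ` {..<m}", OF this]
  show "inj_on (enum_missing p) {..<m}" "p \<notin> enum_missing p ` {..<m}"
    unfolding enum_missing_def n by simp_all
qed

text \<open>The only basis vector that contributes to \<open>det (b, e\<^sub>I)\<close> is the one missing from \<open>I\<close>, so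
  the component of \<open>b\<close> along it can be read off from one value of the form, up to the sign of the
  enumeration.\<close>

definition form_vec :: "'n::{finite,linorder} multi_form \<Rightarrow> (real, 'n) vec" where
  "form_vec \<beta> = (\<chi> p. contract (axis p 1) coord_vol (\<lambda>i. axis (enum_missing p i) 1) *
     \<beta> (\<lambda>i. axis (enum_missing p i) 1))"

lemma alternating_form_reenumerate:
  assumes "alternating_form UNIV m \<omega>" "\<sigma> permutes {..<m}" "\<And>i. i < m \<Longrightarrow> I i = J (\<sigma> i)"
  shows "\<omega> (\<lambda>i. axis (I i) 1) = of_int (sign \<sigma>) * \<omega> (\<lambda>i. axis (J i) 1)"
proof -
  have "\<omega> (\<lambda>i. axis (I i) 1) = \<omega> (\<lambda>i. axis (J (\<sigma> i)) 1)"
    by (rule alternating_form_cong[OF assms(1)]) (simp add: assms(3))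
  then show ?thesis
    using alternating_form_permute[OF assms(1,2), of "\<lambda>i. axis (J i) 1"] by simp
qed

text \<open>Two enumerations of the same indices differ by a permutation, which changes both sides by
  its sign; so agreement on the chosen enumerations gives agreement on all of them.\<close>

lemma contract_form_vec:
  fixes \<beta> :: "'n::{finite,linorder} multi_form"
  assumes n: "CARD('n) = Suc m" and \<beta>: "alternating_form UNIV m \<beta>"
  shows "contract (form_vec \<beta>) coord_vol = \<beta>"
proof (rule alternating_form_eqI)
  note D = alternating_form_coord_vol[where 'n = 'n, unfolded n]
  show "alternating_form UNIV m (contract (form_vec \<beta>) coord_vol)"
    by (rule alternating_form_contract[OF D])
  fix I :: "nat \<Rightarrow> 'n" assume I: "inj_on I {..<m}"
  have "card (I ` {..<m}) \<noteq> CARD('n)" using n I by (simp add: card_image)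
  then obtain p where p: "p \<notin> I ` {..<m}" by (metis UNIV_eq_I)
  define J where "J = enum_missing p"
  note J = enum_missing[OF n, of p, folded J_def]
  have img: "I ` {..<m} = J ` {..<m}"
    using image_missing_one[OF n I p] image_missing_one[OF n J] by simp
  (* the permutation of positions that turns the chosen enumeration into the given one *)
  define \<sigma> where "\<sigma> i = (if i < m then inv_into {..<m} J (I i) else i)" for i
  have bij: "bij_betw \<sigma> {..<m} {..<m}"
  proof -
    have "bij_betw (inv_into {..<m} J \<circ> I) {..<m} {..<m}"
      using I J(1) img
      by (intro bij_betw_trans[of I _ "I ` {..<m}"]) (auto simp: bij_betw_def inj_on_inv_into)
    then show ?thesis by (rule bij_betw_cong[THEN iffD1, rotated]) (simp add: \<sigma>_def)
  qed
  then have \<sigma>: "\<sigma> permutes {..<m}" by (rule bij_imp_permutes) (simp add: \<sigma>_def)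
  have I\<sigma>: "I i = J (\<sigma> i)" if "i < m" for i
    using that img by (auto simp: \<sigma>_def intro!: f_inv_into_f[symmetric])
  let ?e = "\<lambda>I i. axis (I i) 1 :: (real, 'n) vec"
  let ?D = "\<lambda>q. contract (axis q 1) coord_vol (?e I)"
  have "?D q = 0" if "q \<noteq> p" for q
  proof -
    have "q \<in> I ` {..<m}" using image_missing_one[OF n I p] that by simp
    then obtain i where "i < m" "q = I i" by auto
    then show ?thesis unfolding contract_def
      by (intro alternating_form_repeated[OF D, of 0 "Suc i"]) auto
  qed
  then have "contract (form_vec \<beta>) coord_vol (?e I) = (\<Sum>q\<in>{p}. form_vec \<beta> $ q * ?D q)"
    unfolding contract_expand[OF D, of "form_vec \<beta>"] by (intro sum.mono_neutral_right) auto
  also have "\<dots> = contract (axis p 1) coord_vol (?e J) * \<beta> (?e J) * ?D p"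
    by (simp add: form_vec_def J_def)
  also have "?D p = of_int (sign \<sigma>) * contract (axis p 1) coord_vol (?e J)"
    by (rule alternating_form_reenumerate[OF alternating_form_contract[OF D] \<sigma>, of I J]) (rule I\<sigma>)
  also have "contract (axis p 1) coord_vol (?e J) * \<beta> (?e J) *
      (of_int (sign \<sigma>) * contract (axis p 1) coord_vol (?e J)) = of_int (sign \<sigma>) * \<beta> (?e J)"
  proof -
    have "contract (axis p 1) coord_vol (?e J) * contract (axis p 1) coord_vol (?e J) = 1"
      using coord_vol_axis_squared[of "case_nat p J"] J
      unfolding contract_def case_nat_axis n inj_on_case_nat by simp
    then show ?thesis by (simp add: algebra_simps)
  qed
  also have "\<dots> = \<beta> (?e I)"
    by (rule alternating_form_reenumerate[OF \<beta> \<sigma>, of I J, symmetric]) (rule I\<sigma>)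
  finally show "contract (form_vec \<beta>) coord_vol (?e I) = \<beta> (?e I)" .
qed (rule \<beta>)

section \<open>Inner products\<close>

definition spd :: "'n::finite matrix \<Rightarrow> bool" where
  "spd G \<longleftrightarrow> transpose G = G \<and> (\<forall>v. v \<noteq> 0 \<longrightarrow> 0 < v \<bullet> (G *v v))"

lemma spd_symmetric: "spd G \<Longrightarrow> (G *v v) \<bullet> w = v \<bullet> (G *v w)"
  by (metis dot_lmul_matrix spd_def vector_transpose_matrix inner_commute)

text \<open>The determinant does not vanish on the segment of positive definite matrices from the identity
  to \<open>G\<close>, and it is \<open>1\<close> at the identity.\<close>

lemma spd_det_pos:
  fixes G :: "'n::finite matrix"
  assumes "spd G"
  shows "0 < det G"
proof (rule ccontr)
  assume "\<not> 0 < det G"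
  (* the straight path from the identity to G *)
  define H where "H t = (1 - t) *\<^sub>R mat 1 + t *\<^sub>R G" for t :: real
  have nz: "det (H t) \<noteq> 0" if "0 \<le> t" "t \<le> 1" for t
  proof
    assume "det (H t) = 0"
    then obtain v where v: "v \<noteq> 0" "H t *v v = 0"
      using invertible_det_nz[of "H t"] matrix_left_invertible_ker[of "H t"]
      unfolding invertible_left_inverse by blast
    have "0 = v \<bullet> (H t *v v)" using v by simp
    also have "\<dots> = (1 - t) * (v \<bullet> v) + t * (v \<bullet> (G *v v))"
      by (simp add: H_def matrix_vector_mult_add_rdistrib inner_add_right flip: scaleR_matrix_vector_assoc)
    also have "\<dots> > 0"
    proof (cases "t = 0")
      case False
      then have "0 < t * (v \<bullet> (G *v v))" using assms v that by (simp add: spd_def)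
      then show ?thesis using that by (simp add: add_nonneg_pos)
    qed (use v in simp)
    finally show False by simp
  qed
  have "continuous_on {0..1} (\<lambda>t. det (H t))"
    unfolding det_def H_def by (intro continuous_intros)
  moreover have "det (H 0) = 1" "det (H 1) = det G" by (simp_all add: H_def)
  ultimately obtain t where "0 \<le> t" "t \<le> 1" "det (H t) = 0"
    using IVT2'[of "\<lambda>t. det (H t)" 1 0 0] \<open>\<not> 0 < det G\<close> by auto
  then show False using nz by blast
qed

lemma spd_inverse:
  fixes G :: "'n::finite matrix"
  assumes "spd G"
  shows "G *v (matrix_inv G *v v) = v" "matrix_inv G *v (G *v v) = v"
    "det (matrix_inv G) * det G = 1"
proof -
  have "invertible G" using spd_det_pos[OF assms] by (simp add: invertible_det_nz)
  then have "G ** matrix_inv G = mat 1 \<and> matrix_inv G ** G = mat 1"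
    unfolding invertible_def matrix_inv_def by (rule someI_ex)
  then show "G *v (matrix_inv G *v v) = v" "matrix_inv G *v (G *v v) = v"
    "det (matrix_inv G) * det G = 1"
    by (auto simp: matrix_vector_mul_assoc simp flip: det_mul)
qed

lemma contract_volume_inject:
  assumes "spd G" "contract a (volume_form G) = contract b (volume_form G)"
  shows "a = b"
proof -
  have "contract a coord_vol = contract b coord_vol"
    using assms(2) spd_det_pos[OF assms(1)] by (auto simp: fun_eq_iff contract_def volume_form_eq)
  then show ?thesis by (rule contract_coord_vol_inject)
qed

text \<open>The volume form is \<open>sqrt (det G)\<close> times the determinant, which the factor undoes. Written as
  a real power, that factor is visibly smooth in \<open>G\<close>.\<close>

lemma contract_volume_form_vec:
  fixes \<beta> :: "'n::{finite,linorder} multi_form"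
  assumes n: "CARD('n) = Suc m" and \<beta>: "alternating_form UNIV m \<beta>" and G: "spd G"
  shows "contract ((det G powr (-1/2)) *\<^sub>R form_vec \<beta>) (volume_form G) = \<beta>"
proof
  fix v :: "nat \<Rightarrow> (real, 'n) vec"
  note D = alternating_form_coord_vol[where 'n = 'n, unfolded n]
  interpret linear "\<lambda>b. contract b coord_vol v" by (rule linear_contract[OF D])
  have "contract ((det G powr (-1/2)) *\<^sub>R form_vec \<beta>) (volume_form G) v =
      (sqrt (det G) * det G powr (-1/2)) * \<beta> v"
    using scale[of "det G powr (-1/2)" "form_vec \<beta>"] contract_form_vec[OF n \<beta>]
    by (simp add: contract_def volume_form_eq)
  also have "sqrt (det G) * det G powr (-1/2) = 1"
    using spd_det_pos[OF G] by (simp add: powr_half_sqrt[symmetric] flip: powr_add)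
  finally show "contract ((det G powr (-1/2)) *\<^sub>R form_vec \<beta>) (volume_form G) v = \<beta> v" by simp
qed

section \<open>The Hodge star of 1-forms and (n - 1)-forms\<close>

text \<open>Moving an argument from place \<open>k\<close> to the front takes \<open>k\<close> adjacent swaps.\<close>

lemma alternating_form_insert:
  assumes \<omega>: "alternating_form UNIV n \<omega>" and "k < n"
  shows "\<omega> (\<lambda>i. if i < k then v i else if i = k then x else v (i - 1)) = (-1) ^ k * \<omega> (case_nat x v)"
  using \<open>k < n\<close>
proof (induction k)
  case 0
  have "(\<lambda>i. if i = 0 then x else v (i - 1)) = case_nat x v" by (auto split: nat.split)
  then show ?case by simp
next
  case (Suc k)
  let ?w = "\<lambda>k i. if i < k then v i else if i = k then x else v (i - 1)"
  have "?w (Suc k) = (\<lambda>i. ?w k (Transposition.transpose k (Suc k) i))"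
    by (auto simp: Transposition.transpose_def)
  then have "\<omega> (?w (Suc k)) = - \<omega> (?w k)"
    using alternating_form_swap[OF \<omega>, of k "Suc k" "?w k"] Suc.prems by simp
  then show ?case using Suc by simp
qed

lemma volume_form_append:
  fixes G :: "'n::{finite,linorder} matrix"
  assumes n: "CARD('n) = Suc m"
  shows "volume_form G (\<lambda>a. if a < m then v a else w (a - m)) =
    (-1) ^ m * contract (w 0) (volume_form G) v"
proof -
  note V = alternating_form_volume[where 'n = 'n, unfolded n, of G]
  have "volume_form G (\<lambda>a. if a < m then v a else w (a - m)) =
      volume_form G (\<lambda>i. if i < m then v i else if i = m then w 0 else v (i - 1))"
    by (rule alternating_form_cong[OF V]) auto
  also have "\<dots> = (-1) ^ m * contract (w 0) (volume_form G) v"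
    unfolding contract_def by (rule alternating_form_insert[OF V]) simp
  finally show ?thesis .
qed

text \<open>Raising the arguments of \<open>\<iota>\<^sub>b \<mu>\<close> amounts to lowering \<open>b\<close>, since
  \<open>b = G\<^sup>-\<^sup>1 (G b)\<close>; the determinant of \<open>G\<^sup>-\<^sup>1\<close> combines with \<open>sqrt (det G)\<close>.\<close>

lemma contract_volume_raised:
  assumes "spd G"
  shows "contract b (volume_form G) (\<lambda>i. matrix_inv G *v v i) =
    contract (G *v b) coord_vol v / sqrt (det G)"
proof -
  have "case_nat b (\<lambda>i. matrix_inv G *v v i) = (\<lambda>i. matrix_inv G *v case_nat (G *v b) v i)"
    by (auto simp: spd_inverse[OF assms] split: nat.split)
  then have "contract b (volume_form G) (\<lambda>i. matrix_inv G *v v i) =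
      (sqrt (det G) * det (matrix_inv G)) * contract (G *v b) coord_vol v"
    by (simp add: contract_def volume_form_eq coord_vol_linear_image)
  also have "sqrt (det G) * det (matrix_inv G) = 1 / sqrt (det G)"
  proof -
    have "sqrt (det G) * sqrt (det G) = det G" using spd_det_pos[OF assms] by simp
    then have "(sqrt (det G) * det (matrix_inv G)) * sqrt (det G) = 1"
      using spd_inverse(3)[OF assms] by (metis mult.assoc mult.commute)
    then show ?thesis using spd_det_pos[OF assms] by (simp add: field_simps)
  qed
  finally show ?thesis by simp
qed

text \<open>The sign \<open>(-1)\<^sup>m\<close> comes from moving the free argument of the star past the \<open>m\<close> summation
  indices; what remains is the sum in \<open>sum_contract_coord_vol\<close>.\<close>

lemma hodge_contract_volume:
  fixes G :: "'n::{finite,linorder} matrix"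
  assumes n: "CARD('n) = Suc m" and G: "spd G"
  shows "hodge G m (contract b (volume_form G)) w = (-1) ^ m * ((G *v b) \<bullet> w 0)"
proof -
  let ?e = "\<lambda>I i. axis (I i) 1 :: (real, 'n) vec"
  have "contract b (volume_form G) (\<lambda>a. matrix_inv G *v ?e I a) *
      volume_form G (\<lambda>a. if a < m then ?e I a else w (a - m)) =
      (-1) ^ m * (contract (G *v b) coord_vol (?e I) * contract (w 0) coord_vol (?e I))" for I
    unfolding contract_volume_raised[OF G] volume_form_append[OF n, of G "?e I" w]
    using spd_det_pos[OF G] by (simp add: contract_def volume_form_eq field_simps)
  then show ?thesis
    unfolding hodge_def
    by (simp add: sum_contract_coord_vol[OF n] flip: sum_distrib_left)
qed

lemma sum_PiE_single: "(\<Sum>I\<in>{..<1::nat} \<rightarrow>\<^sub>E UNIV. f I) = (\<Sum>p\<in>UNIV. f (\<lambda>i\<in>{..<1}. p))"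
  by (rule sum.reindex_bij_witness[of _ "\<lambda>p. \<lambda>i\<in>{..<1}. p" "\<lambda>I. I 0"])
    (auto simp: PiE_iff extensional_def restrict_def fun_eq_iff intro!: arg_cong[of _ _ f])

text \<open>The components of a covector \<open>G b\<close> after raising the index are those of \<open>b\<close>.\<close>

lemma hodge_one_form:
  fixes G :: "'n::{finite,linorder} matrix"
  assumes G: "spd G"
  shows "hodge G 1 (\<lambda>v. (G *v b) \<bullet> v 0) = contract b (volume_form G)"
proof
  fix w :: "nat \<Rightarrow> (real, 'n) vec"
  obtain m where n: "CARD('n) = Suc m" by (metis not0_implies_Suc zero_less_card_finite less_irrefl)
  have "(G *v b) \<bullet> (matrix_inv G *v axis p 1) = b $ p" for p
    unfolding spd_symmetric[OF G] spd_inverse[OF G] by (simp add: inner_axis)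
  moreover have "(\<lambda>a. if a < 1 then axis ((\<lambda>i\<in>{..<1}. p) a) 1 else w (a - 1)) =
      case_nat (axis p 1) w" for p
    by (auto split: nat.split)
  ultimately have "hodge G 1 (\<lambda>v. (G *v b) \<bullet> v 0) w =
      (\<Sum>p\<in>UNIV. b $ p * volume_form G (case_nat (axis p 1) w))"
    unfolding hodge_def sum_PiE_single by simp
  then show "hodge G 1 (\<lambda>v. (G *v b) \<bullet> v 0) w = contract b (volume_form G) w"
    using contract_expand[OF alternating_form_volume[where 'n = 'n, unfolded n], of b G w]
    by (simp add: contract_def)
qed

lemma sum_PiE_add:
  fixes k l :: nat
  shows "(\<Sum>J\<in>{..<k + l} \<rightarrow>\<^sub>E UNIV. f J) =
   (\<Sum>L\<in>{..<l} \<rightarrow>\<^sub>E UNIV. \<Sum>K\<in>{..<k} \<rightarrow>\<^sub>E UNIV.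
      f (\<lambda>a. if a < k then K a else if a < k + l then L (a - k) else undefined))"
proof -
  have "(\<Sum>J\<in>{..<k + l} \<rightarrow>\<^sub>E UNIV. f J) =
      (\<Sum>(L, K)\<in>({..<l} \<rightarrow>\<^sub>E UNIV) \<times> ({..<k} \<rightarrow>\<^sub>E UNIV).
        f (\<lambda>a. if a < k then K a else if a < k + l then L (a - k) else undefined))"
    by (rule sum.reindex_bij_witness
        [of _ "\<lambda>(L, K) a. if a < k then K a else if a < k + l then L (a - k) else undefined"
          "\<lambda>J. (\<lambda>i\<in>{..<l}. J (k + i), \<lambda>i\<in>{..<k}. J i)"])
      (auto simp: PiE_iff extensional_def restrict_def fun_eq_iff intro!: arg_cong[of _ _ f])
  then show ?thesis by (simp add: sum.cartesian_product)
qed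

text \<open>The signed sum over permutations in the wedge product is absorbed by the sum over all index
  tuples in the star, because the volume form changes by the same sign. The remaining sum over tuples of
  length \<open>k + l\<close> splits, and its part over the first \<open>k\<close> indices is the star of the first factor. For
  \<open>\<tau> = \<star>\<omega>\<close> this expresses the norm of \<open>\<omega>\<close> by the star alone.\<close>

lemma hodge_top_wedge:
  fixes G :: "'n::{finite,linorder} matrix"
  assumes n: "CARD('n) = k + l"
    and \<omega>: "alternating_form UNIV k \<omega>" and \<tau>: "alternating_form UNIV l \<tau>"
  shows "hodge G CARD('n) (wedge k l \<omega> \<tau>) z =
    (\<Sum>L\<in>{..<l} \<rightarrow>\<^sub>E UNIV. \<tau> (\<lambda>i. matrix_inv G *v axis (L i) 1) *
       hodge G k \<omega> (\<lambda>i. axis (L i) 1)) / fact l"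
proof -
  let ?E = "{..<k + l} \<rightarrow>\<^sub>E (UNIV :: 'n set)"
  let ?P = "{\<sigma>. \<sigma> permutes {..<k + l}}"
  note V = alternating_form_volume[where 'n = 'n, unfolded n, of G]
  define r where "r I = (\<lambda>i. matrix_inv G *v axis (I i) 1)" for I :: "nat \<Rightarrow> 'n"
  define vol where "vol I = volume_form G (\<lambda>i. axis (I i) 1)" for I :: "nat \<Rightarrow> 'n"
  define T where "T I = \<omega> (r I) * \<tau> (\<lambda>i. r I (k + i))" for I
  have vol_eq: "volume_form G (\<lambda>a. if a < k + l then axis (I a) 1 else z (a - (k + l))) = vol I" for I
    unfolding vol_def by (rule alternating_form_cong[OF V]) simp
  have vol_perm: "vol (I \<circ> \<sigma>) = of_int (sign \<sigma>) * vol I" if "\<sigma> \<in> ?P" for I \<sigma>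
    using alternating_form_permute[OF V, of \<sigma> "\<lambda>i. axis (I i) 1"] that by (simp add: vol_def)
  have reindex: "(\<Sum>I\<in>?E. f (I \<circ> \<sigma>)) = sum f ?E" if "\<sigma> \<in> ?P" for f :: "_ \<Rightarrow> real" and \<sigma>
  proof (rule sum.reindex_bij_witness[of _ "\<lambda>I. I \<circ> inv \<sigma>" "\<lambda>I. I \<circ> \<sigma>"])
    have \<sigma>: "\<sigma> permutes {..<k + l}" "inv \<sigma> permutes {..<k + l}" using that permutes_inv by auto
    have *: "I \<circ> \<rho> \<in> ?E" if "I \<in> ?E" "\<rho> permutes {..<k + l}" for I \<rho>
      using that permutes_not_in[OF that(2)] by (auto simp: PiE_iff extensional_def)
    show "I \<circ> \<sigma> \<in> ?E" "I \<circ> inv \<sigma> \<in> ?E" if "I \<in> ?E" for I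
      using *[OF that \<sigma>(1)] *[OF that \<sigma>(2)] by auto
    show "I \<circ> \<sigma> \<circ> inv \<sigma> = I" "I \<circ> inv \<sigma> \<circ> \<sigma> = I" for I
      using permutes_inv_o[OF \<sigma>(1)] by (simp_all add: comp_assoc)
  qed simp
  have "hodge G CARD('n) (wedge k l \<omega> \<tau>) z =
      (\<Sum>I\<in>?E. (\<Sum>\<sigma>\<in>?P. of_int (sign \<sigma>) * T (I \<circ> \<sigma>)) / (fact k * fact l) * vol I) / fact (k + l)"
    unfolding hodge_def n wedge_def vol_eq T_def r_def by (simp add: mult.assoc)
  also have "\<dots> = (\<Sum>I\<in>?E. \<Sum>\<sigma>\<in>?P. T (I \<circ> \<sigma>) * vol (I \<circ> \<sigma>)) / (fact k * fact l * fact (k + l))"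
    by (simp add: vol_perm sum_divide_distrib sum_distrib_left mult_ac)
  also have "(\<Sum>I\<in>?E. \<Sum>\<sigma>\<in>?P. T (I \<circ> \<sigma>) * vol (I \<circ> \<sigma>)) = (\<Sum>\<sigma>\<in>?P. \<Sum>I\<in>?E. T I * vol I)"
    by (subst sum.swap, rule sum.cong[OF refl], rule reindex)
  also have "\<dots> = fact (k + l) * (\<Sum>I\<in>?E. T I * vol I)"
    using card_permutations[of "{..<k + l}" "k + l"] by simp
  also have "\<dots> / (fact k * fact l * fact (k + l)) = (\<Sum>I\<in>?E. T I * vol I) / (fact k * fact l)"
    by simp
  also have "(\<Sum>I\<in>?E. T I * vol I) = (\<Sum>L\<in>{..<l} \<rightarrow>\<^sub>E UNIV. \<Sum>K\<in>{..<k} \<rightarrow>\<^sub>E UNIV.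
      \<tau> (r L) * (\<omega> (r K) * volume_form G (\<lambda>a. if a < k then axis (K a) 1 else axis (L (a - k)) 1)))"
    unfolding sum_PiE_add
  proof (intro sum.cong refl)
    fix L K :: "nat \<Rightarrow> 'n"
    let ?J = "\<lambda>a. if a < k then K a else if a < k + l then L (a - k) else undefined"
    have "\<omega> (r ?J) = \<omega> (r K)" by (rule alternating_form_cong[OF \<omega>]) (simp add: r_def)
    moreover have "\<tau> (\<lambda>i. r ?J (k + i)) = \<tau> (r L)"
      by (rule alternating_form_cong[OF \<tau>]) (simp add: r_def)
    moreover have "vol ?J = volume_form G (\<lambda>a. if a < k then axis (K a) 1 else axis (L (a - k)) 1)"
      unfolding vol_def by (rule alternating_form_cong[OF V]) simp
    ultimately show "T ?J * vol ?J = \<tau> (r L) *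
        (\<omega> (r K) * volume_form G (\<lambda>a. if a < k then axis (K a) 1 else axis (L (a - k)) 1))"
      by (simp add: T_def)
  qed
  also have "\<dots> / (fact k * fact l) =
      (\<Sum>L\<in>{..<l} \<rightarrow>\<^sub>E UNIV. \<tau> (r L) * hodge G k \<omega> (\<lambda>i. axis (L i) 1)) / fact l"
    by (simp add: hodge_def r_def sum_distrib_left sum_divide_distrib)
  finally show ?thesis by (simp add: r_def)
qed

lemma alternating_form_inner: "alternating_form UNIV 1 (\<lambda>v. a \<bullet> v 0)"
  by (rule alternating_formI) (auto intro!: linearI simp: inner_add_right)

lemma form_norm_one_form:
  fixes G :: "'n::{finite,linorder} matrix"
  assumes G: "spd G"
  shows "form_norm G 1 (\<lambda>v. (G *v b) \<bullet> v 0) = sqrt (b \<bullet> (G *v b))"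
proof -
  obtain m where n: "CARD('n) = Suc m" by (metis not0_implies_Suc zero_less_card_finite less_irrefl)
  note V = alternating_form_volume[where 'n = 'n, unfolded n, of G]
  let ?e = "\<lambda>I i. axis (I i) 1 :: (real, 'n) vec"
  let ?\<beta> = "contract b (volume_form G)"
  have "hodge G CARD('n) (wedge 1 m (\<lambda>v. (G *v b) \<bullet> v 0) ?\<beta>) (\<lambda>_. 0) =
      (\<Sum>L\<in>{..<m} \<rightarrow>\<^sub>E UNIV. ?\<beta> (\<lambda>i. matrix_inv G *v ?e L i) * ?\<beta> (?e L)) / fact m"
    using n by (subst hodge_top_wedge)
      (auto intro!: alternating_form_inner[simplified] alternating_form_contract[OF V]
        simp: hodge_one_form[OF G, simplified])
  also have "\<dots> = (-1) ^ m * hodge G m ?\<beta> (\<lambda>_. b)"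
    unfolding hodge_def volume_form_append[OF n, of G "?e _" "\<lambda>_. b"]
    by (simp add: sum_distrib_left mult_ac flip: power_add)
  also have "\<dots> = b \<bullet> (G *v b)"
    unfolding hodge_contract_volume[OF n G] by (simp add: inner_commute flip: power_add)
  finally show ?thesis
    unfolding form_norm_def hodge_one_form[OF G] using n by simp
qed

lemma form_norm_contract_volume:
  fixes G :: "'n::{finite,linorder} matrix"
  assumes n: "CARD('n) = Suc m" and G: "spd G"
  shows "form_norm G m (contract b (volume_form G)) = sqrt (b \<bullet> (G *v b))"
proof -
  note V = alternating_form_volume[where 'n = 'n, unfolded n, of G]
  let ?\<alpha> = "\<lambda>w. ((-1) ^ m *\<^sub>R (G *v b)) \<bullet> w 0"
  have star: "hodge G m (contract b (volume_form G)) = ?\<alpha>"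
    by (rule ext) (simp add: hodge_contract_volume[OF n G])
  have "hodge G CARD('n) (wedge m 1 (contract b (volume_form G)) ?\<alpha>) (\<lambda>_. 0) =
      (\<Sum>L\<in>{..<1::nat} \<rightarrow>\<^sub>E UNIV. ?\<alpha> (\<lambda>i. matrix_inv G *v axis (L i) 1) * ?\<alpha> (\<lambda>i. axis (L i) 1)) / fact 1"
    by (subst hodge_top_wedge[OF _ alternating_form_contract[OF V] alternating_form_inner])
      (simp_all add: n star)
  also have "\<dots> = (\<Sum>p\<in>UNIV. ((G *v b) \<bullet> (matrix_inv G *v axis p 1)) * ((G *v b) \<bullet> axis p 1))"
  proof -
    have sign_cancel: "(-1) ^ m * x * ((-1) ^ m * y) = x * y" for x y :: real by (cases "even m") simp_all
    show ?thesis unfolding sum_PiE_single by (simp add: sign_cancel)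
  qed
  also have "\<dots> = b \<bullet> (G *v b)"
    unfolding spd_symmetric[OF G, of b "matrix_inv G *v _"] spd_inverse[OF G]
    by (simp add: inner_axis inner_vec_def[of b])
  finally show ?thesis unfolding form_norm_def star using n by simp
qed

section \<open>Partial derivatives and the lowered acceleration\<close>

lemma frechet_derivative_within_cong:
  assumes "x \<in> S" "\<And>y. y \<in> S \<Longrightarrow> f y = g y"
  shows "frechet_derivative f (at x within S) = frechet_derivative g (at x within S)"
proof -
  have "(f has_derivative f') (at x within S) \<longleftrightarrow> (g has_derivative f') (at x within S)" for f'
    using has_derivative_transform[OF assms(1), of f g f'] has_derivative_transform[OF assms(1), of g f f']
      assms(2) by auto
  then show ?thesis by (simp add: frechet_derivative_def)
qed

lemma frechet_derivative_eq_sum_partial_deriv: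
  fixes f :: "real ^ 'n::finite \<Rightarrow> real"
  assumes "f differentiable (at x within S)"
  shows "frechet_derivative f (at x within S) v = (\<Sum>i\<in>UNIV. v $ i * partial_deriv S i f x)"
proof -
  interpret linear "frechet_derivative f (at x within S)"
    by (rule linear_frechet_derivative[OF assms])
  have "frechet_derivative f (at x within S) v =
      frechet_derivative f (at x within S) (\<Sum>i\<in>UNIV. v $ i *\<^sub>R axis i 1)"
    using basis_expansion[of v] by (simp add: scalar_mult_eq_scaleR)
  then show ?thesis by (simp add: sum scale partial_deriv_def)
qed

lemma partial_deriv_cong:
  assumes "x \<in> S" "\<And>y. y \<in> S \<Longrightarrow> f y = g y"
  shows "partial_deriv S i f x = partial_deriv S i g x"
  unfolding partial_deriv_def using frechet_derivative_within_cong[OF assms] by simp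

lemma partial_deriv_mult:
  fixes S :: "(real ^ 'n::{finite,linorder}) set"
  assumes S: "openin (top_of_set half_space) S" "x \<in> S"
    and "f differentiable (at x within S)" "g differentiable (at x within S)"
  shows "partial_deriv S i (\<lambda>y. f y * g y) x = f x * partial_deriv S i g x + partial_deriv S i f x * g x"
proof -
  have "((\<lambda>y. f y * g y) has_derivative (\<lambda>v. f x * frechet_derivative g (at x within S) v +
      frechet_derivative f (at x within S) v * g x)) (at x within S)"
    using assms(3,4) by (intro has_derivative_mult frechet_derivative_works[THEN iffD1])
  from half_space_frechet_derivativeI[OF S this] show ?thesis by (simp add: partial_deriv_def)
qed

lemma partial_deriv_sum:
  fixes S :: "(real ^ 'n::{finite,linorder}) set"
  assumes S: "openin (top_of_set half_space) S" "x \<in> S"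
    and "\<And>k. k \<in> I \<Longrightarrow> f k differentiable (at x within S)"
  shows "partial_deriv S i (\<lambda>y. \<Sum>k\<in>I. f k y) x = (\<Sum>k\<in>I. partial_deriv S i (f k) x)"
proof -
  have "((\<lambda>y. \<Sum>k\<in>I. f k y) has_derivative
      (\<lambda>v. \<Sum>k\<in>I. frechet_derivative (f k) (at x within S) v)) (at x within S)"
    using assms(3) by (intro has_derivative_sum frechet_derivative_works[THEN iffD1])
  from half_space_frechet_derivativeI[OF S this] show ?thesis by (simp add: partial_deriv_def)
qed

text \<open>In components, that an alternating bilinear form vanishes on a pair of equal vectors.\<close>

lemma sum_antisymmetric:
  fixes u :: "'i \<Rightarrow> real"
  shows "(\<Sum>l\<in>I. u l * (\<Sum>i\<in>I. u i * (d i l - d l i))) = 0"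
proof -
  have "(\<Sum>l\<in>I. \<Sum>i\<in>I. u l * (u i * d i l)) = (\<Sum>l\<in>I. \<Sum>i\<in>I. u l * (u i * d l i))"
    by (subst sum.swap) (simp add: mult.left_commute)
  then show ?thesis by (simp add: sum_distrib_left right_diff_distrib sum_subtractf)
qed

text \<open>The coordinate form of \<open>g(\<nabla>\<^sub>Y Y) = h \<iota>\<^sub>Y d\<alpha> + Y(h) \<alpha>\<close> for a vector field with
  \<open>g Y = h \<alpha>\<close> and \<open>\<alpha>(Y) = h\<close>, that is, of norm \<open>h\<close> and with \<open>\<alpha>\<close> dual to the unit vector along
  it. Lowering the index cancels the inverse matrix in the Christoffel symbols. The derivatives of the
  metric are then eliminated by differentiating \<open>g Y = h \<alpha>\<close> (fact \<open>E1\<close>), and those of \<open>Y\<close> by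
  differentiating \<open>\<alpha>(Y) = h\<close> (fact \<open>E2\<close>).\<close>

lemma levi_civita_lowered:
  fixes g :: "('m, 'n::{finite,linorder}) metric_field" and Y :: "('m, 'n) vec_field"
    and a :: "(real, 'n) vec \<Rightarrow> (real, 'n) vec" and h :: "(real, 'n) vec \<Rightarrow> real"
  assumes S: "openin (top_of_set half_space) (coord_dom c)" "x \<in> coord_dom c"
    and diff: "\<And>i j. (\<lambda>y. g c y $ i $ j) differentiable (at x within coord_dom c)"
      "\<And>k. (\<lambda>y. Y c y $ k) differentiable (at x within coord_dom c)"
      "\<And>k. (\<lambda>y. a y $ k) differentiable (at x within coord_dom c)"
      "h differentiable (at x within coord_dom c)"
    and spd: "\<And>y. y \<in> coord_dom c \<Longrightarrow> spd (g c y)"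
    and flat: "\<And>y. y \<in> coord_dom c \<Longrightarrow> g c y *v Y c y = h y *\<^sub>R a y"
    and unit: "\<And>y. y \<in> coord_dom c \<Longrightarrow> a y \<bullet> Y c y = h y"
  shows "(g c x *v levi_civita g Y Y c x) $ l =
    (\<Sum>i\<in>UNIV. Y c x $ i * partial_deriv (coord_dom c) i h x) * a x $ l +
    h x * (\<Sum>i\<in>UNIV. Y c x $ i * (partial_deriv (coord_dom c) i (\<lambda>y. a y $ l) x -
                                 partial_deriv (coord_dom c) l (\<lambda>y. a y $ i) x))"
proof -
  define G where "G = g c x"
  define u where "u = Y c x"
  define dg where "dg i j k = partial_deriv (coord_dom c) i (\<lambda>y. g c y $ j $ k) x" for i j k
  define dY where "dY i k = partial_deriv (coord_dom c) i (\<lambda>y. Y c y $ k) x" for i k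
  define da where "da i k = partial_deriv (coord_dom c) i (\<lambda>y. a y $ k) x" for i k
  define dh where "dh i = partial_deriv (coord_dom c) i h x" for i
  note pd_mult = partial_deriv_mult[OF S] and pd_sum = partial_deriv_sum[OF S]
  have symm: "g c y $ i $ j = g c y $ j $ i" if "y \<in> coord_dom c" for y i j
  proof -
    have "transpose (g c y) $ j $ i = g c y $ j $ i" using spd[OF that] by (simp add: spd_def)
    then show ?thesis by (simp add: transpose_def)
  qed
  have dg_sym: "dg i j k = dg i k j" for i j k
    unfolding dg_def by (rule partial_deriv_cong[OF S(2)]) (rule symm)
  have G_sym: "G $ i $ j = G $ j $ i" for i j unfolding G_def by (rule symm[OF S(2)])
  have E0: "(\<Sum>k\<in>UNIV. G $ i $ k * u $ k) = h x * a x $ i" for i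
    using arg_cong[OF flat[OF S(2)], of "\<lambda>v. v $ i"]
    by (simp add: G_def u_def matrix_vector_mult_def)
  have E1: "(\<Sum>k\<in>UNIV. G $ j $ k * dY i k) + (\<Sum>k\<in>UNIV. dg i j k * u $ k) = h x * da i j + dh i * a x $ j"
    for i j
  proof -
    have "partial_deriv (coord_dom c) i (\<lambda>y. \<Sum>k\<in>UNIV. g c y $ j $ k * Y c y $ k) x =
        (\<Sum>k\<in>UNIV. G $ j $ k * dY i k + dg i j k * u $ k)"
      by (simp add: pd_sum pd_mult diff differentiable_mult G_def dY_def dg_def u_def)
    moreover have "partial_deriv (coord_dom c) i (\<lambda>y. \<Sum>k\<in>UNIV. g c y $ j $ k * Y c y $ k) x =
        partial_deriv (coord_dom c) i (\<lambda>y. h y * a y $ j) x"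
      by (rule partial_deriv_cong[OF S(2)])
        (use arg_cong[OF flat, of _ "\<lambda>v. v $ j"] in \<open>simp add: matrix_vector_mult_def\<close>)
    ultimately show ?thesis
      by (simp add: pd_mult diff da_def dh_def sum.distrib)
  qed
  have E2: "(\<Sum>i\<in>UNIV. a x $ i * dY k i) + (\<Sum>i\<in>UNIV. da k i * u $ i) = dh k" for k
  proof -
    have "partial_deriv (coord_dom c) k (\<lambda>y. \<Sum>i\<in>UNIV. a y $ i * Y c y $ i) x =
        (\<Sum>i\<in>UNIV. a x $ i * dY k i + da k i * u $ i)"
      by (simp add: pd_sum pd_mult diff differentiable_mult dY_def da_def u_def)
    moreover have "partial_deriv (coord_dom c) k (\<lambda>y. \<Sum>i\<in>UNIV. a y $ i * Y c y $ i) x = dh k"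
      unfolding dh_def by (rule partial_deriv_cong[OF S(2)])
        (use unit in \<open>simp add: inner_vec_def\<close>)
    ultimately show ?thesis by (simp add: sum.distrib)
  qed
  (* V and W are the derivative part and the lowered Christoffel part of the acceleration *)
  define V where "V = (\<chi> k. \<Sum>i\<in>UNIV. u $ i * dY i k)"
  define W where "W = (\<chi> k. (\<Sum>i\<in>UNIV. \<Sum>j\<in>UNIV. u $ i * u $ j * (dg i j k + dg j i k - dg k i j)) / 2)"
  have "levi_civita g Y Y c x = V + matrix_inv G *v W"
  proof (rule vec_eq_iff[THEN iffD2], rule allI)
    fix k
    have "(\<Sum>i\<in>UNIV. \<Sum>j\<in>UNIV. christoffel g c x k i j * u $ i * u $ j) =
      (\<Sum>i\<in>UNIV. \<Sum>j\<in>UNIV. \<Sum>l\<in>UNIV. matrix_inv G $ k $ l *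
        (u $ i * u $ j * (dg i j l + dg j i l - dg l i j) / 2))"
      unfolding christoffel_def G_def[symmetric] dg_def[symmetric]
      by (simp add: sum_distrib_left sum_distrib_right sum_divide_distrib mult_ac)
    also have "\<dots> = (\<Sum>l\<in>UNIV. \<Sum>i\<in>UNIV. \<Sum>j\<in>UNIV. matrix_inv G $ k $ l *
        (u $ i * u $ j * (dg i j l + dg j i l - dg l i j) / 2))"
      by (subst (2) sum.swap, subst sum.swap) simp
    also have "\<dots> = (matrix_inv G *v W) $ k"
      by (simp add: matrix_vector_mult_def W_def sum_distrib_left sum_divide_distrib)
    finally show "levi_civita g Y Y c x $ k = (V + matrix_inv G *v W) $ k"
      by (simp add: levi_civita_def V_def u_def dY_def)
  qed
  then have "(g c x *v levi_civita g Y Y c x) $ l = (G *v V) $ l + W $ l"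
    using spd[OF S(2)] by (simp add: G_def matrix_vector_right_distrib spd_inverse)
  also have "(G *v V) $ l = (\<Sum>i\<in>UNIV. u $ i * (\<Sum>k\<in>UNIV. G $ l $ k * dY i k))"
    unfolding matrix_vector_mult_def V_def
    by (simp add: sum_distrib_left mult_ac) (rule sum.swap)
  also have "W $ l = (\<Sum>i\<in>UNIV. u $ i * (\<Sum>j\<in>UNIV. dg i l j * u $ j)) -
      (\<Sum>i\<in>UNIV. u $ i * (\<Sum>j\<in>UNIV. dg l i j * u $ j)) / 2"
  proof -
    have "(\<Sum>i\<in>UNIV. \<Sum>j\<in>UNIV. u $ i * u $ j * dg j i l) = (\<Sum>i\<in>UNIV. \<Sum>j\<in>UNIV. u $ i * u $ j * dg i j l)"
      by (subst sum.swap) (simp add: mult.commute)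
    then show ?thesis
      by (simp add: W_def dg_sym[of _ l] algebra_simps sum.distrib sum_subtractf sum_distrib_left diff_divide_distrib)
  qed
  also have "(\<Sum>i\<in>UNIV. u $ i * (\<Sum>j\<in>UNIV. dg l i j * u $ j)) = 2 * h x * (\<Sum>i\<in>UNIV. u $ i * da l i)"
  proof -
    have "(\<Sum>i\<in>UNIV. u $ i * (\<Sum>j\<in>UNIV. dg l i j * u $ j)) =
        (\<Sum>i\<in>UNIV. u $ i * (h x * da l i + dh l * a x $ i - (\<Sum>k\<in>UNIV. G $ i $ k * dY l k)))"
      by (intro sum.cong refl arg_cong2[of _ _ _ _ "(*)"]) (use E1[of _ l] in \<open>simp add: algebra_simps\<close>)
    also have "\<dots> = h x * (\<Sum>i\<in>UNIV. u $ i * da l i) + dh l * (\<Sum>i\<in>UNIV. u $ i * a x $ i) -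
        (\<Sum>i\<in>UNIV. u $ i * (\<Sum>k\<in>UNIV. G $ i $ k * dY l k))"
      by (simp add: algebra_simps sum.distrib sum_subtractf sum_distrib_left)
    also have "(\<Sum>i\<in>UNIV. u $ i * a x $ i) = h x"
      using unit[OF S(2)] by (simp add: inner_vec_def u_def mult.commute)
    also have "(\<Sum>i\<in>UNIV. u $ i * (\<Sum>k\<in>UNIV. G $ i $ k * dY l k)) =
        (\<Sum>k\<in>UNIV. dY l k * (\<Sum>i\<in>UNIV. G $ k $ i * u $ i))"
      by (simp add: sum_distrib_left) (subst sum.swap, simp add: G_sym mult_ac)
    also have "\<dots> = h x * (\<Sum>k\<in>UNIV. a x $ k * dY l k)"
      unfolding E0 by (simp add: sum_distrib_left mult_ac)
    also have "(\<Sum>k\<in>UNIV. a x $ k * dY l k) = dh l - (\<Sum>i\<in>UNIV. u $ i * da l i)"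
      using E2[of l] by (simp add: algebra_simps)
    finally show ?thesis by (simp add: algebra_simps)
  qed
  also have "(\<Sum>i\<in>UNIV. u $ i * (\<Sum>k\<in>UNIV. G $ l $ k * dY i k)) +
      ((\<Sum>i\<in>UNIV. u $ i * (\<Sum>j\<in>UNIV. dg i l j * u $ j)) - 2 * h x * (\<Sum>i\<in>UNIV. u $ i * da l i) / 2) =
      (\<Sum>i\<in>UNIV. u $ i * (h x * da i l + dh i * a x $ l)) - h x * (\<Sum>i\<in>UNIV. u $ i * da l i)"
    unfolding E1[symmetric] by (simp add: distrib_left sum.distrib)
  also have "\<dots> = (\<Sum>i\<in>UNIV. u $ i * dh i) * a x $ l + h x * (\<Sum>i\<in>UNIV. u $ i * (da i l - da l i))"
    by (simp add: algebra_simps sum.distrib sum_subtractf sum_distrib_left)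
  finally show ?thesis by (simp add: u_def da_def dh_def)
qed

section \<open>Charts\<close>

lemma chart_domains:
  assumes "is_chart X c"
  shows "openin (top_of_set half_space) (coord_dom c)" "inj_on (snd c) (fst c)"
proof -
  show "openin (top_of_set half_space) (coord_dom c)" using assms by (simp add: is_chart_def)
  have "fst c \<subseteq> topspace X" using assms by (simp add: is_chart_def openin_subset)
  then have top: "topspace (subtopology X (fst c)) = fst c"
    by (simp add: topspace_subtopology Int_absorb1)
  have "homeomorphic_map (subtopology X (fst c)) (top_of_set (coord_dom c)) (snd c)"
    using assms by (simp add: is_chart_def)
  from homeomorphic_imp_injective_map[OF this] show "inj_on (snd c) (fst c)" by (simp only: top)
qed

lemma param_coord:
  assumes "is_chart X c" "p \<in> fst c"
  shows "param c (snd c p) = p"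
  unfolding param_def using chart_domains(2)[OF assms(1)] assms(2) by (rule inv_into_f_f)

lemma openin_overlap:
  assumes "is_chart X c" "is_chart X d"
  shows "openin (top_of_set half_space) (overlap c d)"
proof -
  have "homeomorphic_map (subtopology X (fst c)) (top_of_set (coord_dom c)) (snd c)"
    using assms by (simp add: is_chart_def)
  then have "open_map (subtopology X (fst c)) (top_of_set (coord_dom c)) (snd c)"
    by (rule homeomorphic_imp_open_map)
  moreover have "openin (subtopology X (fst c)) (fst c \<inter> fst d)"
    using assms by (simp add: is_chart_def openin_subtopology_Int2)
  ultimately have "openin (top_of_set (coord_dom c)) (overlap c d)"
    by (simp add: open_map_def overlap_def)
  then show ?thesis using chart_domains(1)[OF assms(1)] by (rule openin_trans)
qed

lemma overlap_coord:
  assumes "is_chart X c" "x \<in> overlap c d"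
  obtains p where "p \<in> fst c" "p \<in> fst d" "x = snd c p" "param c x = p" "transition c d x = snd d p"
  using assms param_coord[OF assms(1)] by (auto simp: overlap_def transition_def)

lemma overlap_subset: "overlap c d \<subseteq> coord_dom c"
  by (auto simp: overlap_def coord_dom_def)

lemma transition_in_coord_dom:
  assumes "is_chart X c" "x \<in> overlap c d"
  shows "transition c d x \<in> coord_dom d"
  using overlap_coord[OF assms] by (metis coord_dom_def imageI)

lemma transition_has_derivative:
  assumes "oriented_manifold_with_boundary X A" "c \<in> A" "d \<in> A" "x \<in> overlap c d"
  shows "(transition c d has_derivative transition_deriv c d x) (at x within overlap c d)"
proof -
  have "smooth_on (overlap c d) (transition c d)"
    using assms by (simp add: oriented_manifold_with_boundary_def)
  from smooth_on_differentiable[OF this assms(4)] show ?thesis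
    unfolding transition_deriv_def by (rule frechet_derivative_works[THEN iffD1])
qed

text \<open>The chain rule for the two coordinate expressions of one function. The derivatives within
  the chart domains restrict to derivatives within the overlap, where they are unique because the overlap is
  relatively open in the half-space.\<close>

lemma frechet_derivative_transition:
  assumes M: "oriented_manifold_with_boundary X A" "c \<in> A" "d \<in> A" "x \<in> overlap c d"
    and f: "f differentiable (at x within coord_dom c)"
    and f': "f' differentiable (at (transition c d x) within coord_dom d)"
    and eq: "\<And>y. y \<in> overlap c d \<Longrightarrow> f y = f' (transition c d y)"
  shows "frechet_derivative f (at x within coord_dom c) v =
    frechet_derivative f' (at (transition c d x) within coord_dom d) (transition_deriv c d x v)"
proof -
  have charts: "is_chart X c" "is_chart X d"
    using M by (auto simp: oriented_manifold_with_boundary_def)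
  have "(f' has_derivative frechet_derivative f' (at (transition c d x) within coord_dom d))
      (at (transition c d x) within transition c d ` overlap c d)"
    by (rule has_derivative_subset[OF frechet_derivative_works[THEN iffD1, OF f']])
      (intro image_subsetI transition_in_coord_dom[OF charts(1)])
  from diff_chain_within[OF transition_has_derivative[OF M] this]
  have "((\<lambda>y. f' (transition c d y)) has_derivative
      frechet_derivative f' (at (transition c d x) within coord_dom d) \<circ> transition_deriv c d x)
      (at x within overlap c d)" by (simp add: o_def)
  then have "(f has_derivative
      frechet_derivative f' (at (transition c d x) within coord_dom d) \<circ> transition_deriv c d x)
      (at x within overlap c d)"
    by (rule has_derivative_transform[OF M(4), rotated]) (rule eq)
  moreover have "(f has_derivative frechet_derivative f (at x within coord_dom c)) (at x within overlap c d)"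
    by (rule has_derivative_subset[OF frechet_derivative_works[THEN iffD1, OF f] overlap_subset])
  ultimately show ?thesis
    using half_space_has_derivative_unique[OF openin_overlap[OF charts] M(4)] by (metis comp_apply)
qed

section \<open>Exterior derivatives of functions and 1-forms\<close>

lemma ext_d_cong:
  assumes "x \<in> coord_dom c" "\<And>y. y \<in> coord_dom c \<Longrightarrow> \<omega> c y = \<eta> c y"
  shows "ext_d k \<omega> c x = ext_d k \<eta> c x"
proof
  fix v
  have "frechet_derivative (\<lambda>y. \<omega> c y w) (at x within coord_dom c) =
      frechet_derivative (\<lambda>y. \<eta> c y w) (at x within coord_dom c)" for w
    by (rule frechet_derivative_within_cong[OF assms(1)]) (simp add: assms(2))
  then show "ext_d k \<omega> c x v = ext_d k \<eta> c x v" by (simp add: ext_d_def)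
qed

lemma ext_d_fun_form:
  "ext_d 0 (fun_form u) c x v = frechet_derivative (\<lambda>y. u (param c y)) (at x within coord_dom c) (v 0)"
  by (simp add: ext_d_def fun_form_def)

text \<open>The components of \<open>d(s a)\<close> are \<open>s (\<partial>\<^sub>i a\<^sub>l - \<partial>\<^sub>l a\<^sub>i)\<close>.\<close>

lemma ext_d_one_form:
  fixes c :: "('m, 'n::{finite,linorder}) chart"
  assumes S: "openin (top_of_set half_space) (coord_dom c)" "x \<in> coord_dom c"
    and \<omega>: "\<And>y. y \<in> coord_dom c \<Longrightarrow> \<omega> c y = (\<lambda>v. s * (a y \<bullet> v 0))"
    and a: "\<And>k. (\<lambda>y. a y $ k) differentiable (at x within coord_dom c)"
  shows "ext_d 1 \<omega> c x v = s * (\<Sum>l\<in>UNIV. v 1 $ l * (\<Sum>i\<in>UNIV. v 0 $ i *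
    (partial_deriv (coord_dom c) i (\<lambda>y. a y $ l) x - partial_deriv (coord_dom c) l (\<lambda>y. a y $ i) x)))"
proof -
  let ?d = "\<lambda>i k. partial_deriv (coord_dom c) i (\<lambda>y. a y $ k) x"
  have *: "frechet_derivative (\<lambda>y. \<omega> c y w) (at x within coord_dom c) u =
      s * (\<Sum>i\<in>UNIV. \<Sum>k\<in>UNIV. u $ i * (?d i k * w 0 $ k))" for w u
  proof -
    have "((\<lambda>y. s * (\<Sum>k\<in>UNIV. a y $ k * w 0 $ k)) has_derivative (\<lambda>u. s * (\<Sum>k\<in>UNIV.
        frechet_derivative (\<lambda>y. a y $ k) (at x within coord_dom c) u * w 0 $ k))) (at x within coord_dom c)"
      by (intro has_derivative_mult_right has_derivative_sum has_derivative_mult_left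
          frechet_derivative_works[THEN iffD1] a)
    from half_space_frechet_derivativeI[OF S this]
    have "frechet_derivative (\<lambda>y. s * (a y \<bullet> w 0)) (at x within coord_dom c) u =
        s * (\<Sum>k\<in>UNIV. (\<Sum>i\<in>UNIV. u $ i * ?d i k) * w 0 $ k)"
      by (simp add: inner_vec_def frechet_derivative_eq_sum_partial_deriv[OF a])
    moreover have "frechet_derivative (\<lambda>y. \<omega> c y w) (at x within coord_dom c) =
        frechet_derivative (\<lambda>y. s * (a y \<bullet> w 0)) (at x within coord_dom c)"
      by (rule frechet_derivative_within_cong[OF S(2)]) (simp add: \<omega>)
    moreover have "(\<Sum>k\<in>UNIV. (\<Sum>i\<in>UNIV. u $ i * ?d i k) * w 0 $ k) =
        (\<Sum>i\<in>UNIV. \<Sum>k\<in>UNIV. u $ i * (?d i k * w 0 $ k))"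
      by (simp add: sum_distrib_right mult.assoc) (rule sum.swap)
    ultimately show ?thesis by simp
  qed
  have "ext_d 1 \<omega> c x v = s * (\<Sum>i\<in>UNIV. \<Sum>k\<in>UNIV. v 0 $ i * (?d i k * v 1 $ k)) -
      s * (\<Sum>i\<in>UNIV. \<Sum>k\<in>UNIV. v 1 $ i * (?d i k * v 0 $ k))"
    by (simp add: ext_d_def * numeral_eq_Suc)
  also have "(\<Sum>i\<in>UNIV. \<Sum>k\<in>UNIV. v 0 $ i * (?d i k * v 1 $ k)) =
      (\<Sum>l\<in>UNIV. \<Sum>i\<in>UNIV. v 0 $ i * (?d i l * v 1 $ l))" by (rule sum.swap)
  finally show ?thesis
    by (simp add: sum_distrib_left right_diff_distrib sum_subtractf mult_ac)
qed

section \<open>The vector field of a flux form\<close>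

text \<open>The part of the situation that concerns a single metric; both metrics of the conformal pair are
  instances.\<close>

locale flux_form =
  fixes X :: "'m topology" and A :: "('m, 'n::{finite,linorder}) chart set"
    and g :: "('m, 'n) metric_field" and \<beta> :: "('m, 'n) form_field" and m :: nat
  assumes dim: "CARD('n) = Suc m"
    and manifold: "oriented_manifold_with_boundary X A"
    and metric: "riemannian_metric A g"
    and form: "diff_form A m \<beta>"
    and nonzero: "nowhere_vanishing A \<beta>"
begin

abbreviation B :: "('m, 'n) vec_field" where "B \<equiv> assoc_field g \<beta>"

lemma chart: "c \<in> A \<Longrightarrow> is_chart X c"
  using manifold by (simp add: oriented_manifold_with_boundary_def)

lemma openin_coord_dom: "c \<in> A \<Longrightarrow> openin (top_of_set half_space) (coord_dom c)"
  using chart chart_domains(1) by blast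

lemma spd_metric: "c \<in> A \<Longrightarrow> x \<in> coord_dom c \<Longrightarrow> spd (g c x)"
  using metric by (simp add: riemannian_metric_def spd_def)

lemma alternating_form: "c \<in> A \<Longrightarrow> x \<in> coord_dom c \<Longrightarrow> alternating_form UNIV m (\<beta> c x)"
  using form by (simp add: diff_form_def diff_form_on_def)

lemma assoc_field_eqI:
  assumes "c \<in> A" "x \<in> coord_dom c" "contract b (volume_form (g c x)) = \<beta> c x"
  shows "B c x = b"
  unfolding assoc_field_def
  using assms(3) contract_volume_inject[OF spd_metric[OF assms(1,2)]] by (intro the_equality) auto

lemma assoc_field_eq:
  assumes "c \<in> A" "x \<in> coord_dom c"
  shows "B c x = (det (g c x) powr (-1/2)) *\<^sub>R form_vec (\<beta> c x)"
  by (rule assoc_field_eqI[OF assms contract_volume_form_vec[OF dim alternating_form[OF assms] spd_metric[OF assms]]])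

lemma contract_assoc_field:
  assumes "c \<in> A" "x \<in> coord_dom c"
  shows "contract (B c x) (volume_form (g c x)) = \<beta> c x"
  unfolding assoc_field_eq[OF assms]
  by (rule contract_volume_form_vec[OF dim alternating_form[OF assms] spd_metric[OF assms]])

lemma assoc_field_nonzero:
  assumes "c \<in> A" "x \<in> coord_dom c"
  shows "B c x \<noteq> 0"
proof
  assume "B c x = 0"
  then have "\<beta> c x = contract 0 (volume_form (g c x))" using contract_assoc_field[OF assms] by simp
  moreover have "contract 0 (volume_form (g c x)) v = 0" for v
    using linear_0[OF linear_contract[OF alternating_form_volume[where 'n = 'n, unfolded dim]]] by blast
  ultimately have "\<beta> c x = (\<lambda>v. 0)" by (simp add: fun_eq_iff)
  then show False using nonzero assms by (simp add: nowhere_vanishing_def)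
qed

lemma star_eq:
  assumes "c \<in> A" "x \<in> coord_dom c"
  shows "star g m \<beta> c x = (\<lambda>v. (-1) ^ m * ((g c x *v B c x) \<bullet> v 0))"
  using hodge_contract_volume[OF dim spd_metric[OF assms], of "B c x"]
  unfolding star_def contract_assoc_field[OF assms] by blast

lemma form_norm_eq:
  assumes "c \<in> A" "x \<in> coord_dom c"
  shows "form_norm (g c x) m (\<beta> c x) = sqrt (B c x \<bullet> (g c x *v B c x))"
  using form_norm_contract_volume[OF dim spd_metric[OF assms], of "B c x"]
  unfolding contract_assoc_field[OF assms] .

lemma smooth_metric: "c \<in> A \<Longrightarrow> smooth_on (coord_dom c) (\<lambda>x. g c x $ i $ j)"
  using metric by (auto simp: riemannian_metric_def intro!: smooth_on_vec_nth)

text \<open>The components are a fixed signed selection of the components of the form, divided by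
  \<open>sqrt (det g)\<close>.\<close>

lemma smooth_assoc_field:
  assumes c: "c \<in> A"
  shows "smooth_on (coord_dom c) (\<lambda>x. B c x $ k)"
proof -
  have "smooth_on (coord_dom c) (\<lambda>x. \<beta> c x v)" for v
    using form c by (simp add: diff_form_def diff_form_on_def)
  then have "smooth_on (coord_dom c) (\<lambda>x. form_vec (\<beta> c x) $ k)"
    by (simp add: form_vec_def smooth_on_mult smooth_on_const)
  moreover have "smooth_on (coord_dom c) (\<lambda>x. det (g c x) powr (-1/2))"
    using metric c spd_det_pos[OF spd_metric[OF c]]
    by (intro smooth_on_powr smooth_on_det) (auto simp: riemannian_metric_def)
  ultimately have "smooth_on (coord_dom c) (\<lambda>x. det (g c x) powr (-1/2) * form_vec (\<beta> c x) $ k)"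
    by (rule smooth_on_mult[rotated])
  then show ?thesis by (rule smooth_on_cong) (simp add: assoc_field_eq[OF c])
qed

lemma smooth_flat:
  assumes "c \<in> A"
  shows "smooth_on (coord_dom c) (\<lambda>x. (g c x *v B c x) $ k)"
  unfolding matrix_vector_mult_def
  by (simp add: smooth_on_sum smooth_on_mult smooth_metric[OF assms] smooth_assoc_field[OF assms])

lemma smooth_norm_squared:
  assumes "c \<in> A"
  shows "smooth_on (coord_dom c) (\<lambda>x. B c x \<bullet> (g c x *v B c x))"
  unfolding inner_vec_def inner_real_def
  by (intro smooth_on_sum smooth_on_mult smooth_assoc_field[OF assms] smooth_flat[OF assms])

lemma norm_squared_pos:
  assumes "c \<in> A" "x \<in> coord_dom c"
  shows "0 < B c x \<bullet> (g c x *v B c x)"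
  using spd_metric[OF assms] assoc_field_nonzero[OF assms] by (simp add: spd_def)

context
  fixes c d x assumes cd: "c \<in> A" "d \<in> A" and x: "x \<in> overlap c d"
begin

lemma transition_deriv_matrix:
  "transition_deriv c d x v = matrix (transition_deriv c d x) *v v"
  using transition_has_derivative[OF manifold cd x]
  by (simp add: has_derivative_linear matrix_works)

lemma metric_transition:
  "v \<bullet> (g c x *v w) =
    transition_deriv c d x v \<bullet> (g d (transition c d x) *v transition_deriv c d x w)"
  using metric cd x by (simp add: riemannian_metric_def)

lemma transition_in: "x \<in> coord_dom c" "transition c d x \<in> coord_dom d"
  using overlap_subset[of c d] x transition_in_coord_dom[OF chart[OF cd(1)] x] by auto

text \<open>The metrics are related by \<open>g = P\<^sup>T g' P\<close> with \<open>P\<close> the Jacobian matrix, so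
  \<open>det g = (det P)\<^sup>2 det g'\<close>. Orientation enters here: the square root of \<open>(det P)\<^sup>2\<close> is \<open>det P\<close>.\<close>

lemma volume_form_transition:
  "volume_form (g d (transition c d x)) (\<lambda>i. transition_deriv c d x (v i)) = volume_form (g c x) v"
proof -
  define P where "P = matrix (transition_deriv c d x)"
  have P: "0 < det P" using manifold cd x by (simp add: P_def oriented_manifold_with_boundary_def)
  have "v \<bullet> (g c x *v w) = v \<bullet> ((transpose P ** g d (transition c d x) ** P) *v w)" for v w
    unfolding metric_transition transition_deriv_matrix P_def[symmetric]
    using dot_lmul_matrix[of "g d (transition c d x) *v (P *v w)" P v]
    by (simp add: inner_commute flip: matrix_vector_mul_assoc)
  then have "g c x = transpose P ** g d (transition c d x) ** P"
    by (metis matrix_eq vector_eq_ldot)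
  then have "det (g c x) = (det P)\<^sup>2 * det (g d (transition c d x))"
    by (simp add: det_mul power2_eq_square)
  then show ?thesis
    using P unfolding transition_deriv_matrix P_def[symmetric] volume_form_eq coord_vol_linear_image
    by (simp add: real_sqrt_mult)
qed

text \<open>Both the form and the volume form are invariant, so the image of the vector solves the
  equation that defines the vector in the other chart.\<close>

lemma assoc_field_transition: "B d (transition c d x) = transition_deriv c d x (B c x)"
proof (rule assoc_field_eqI[OF cd(2) transition_in(2)])
  define P where "P = matrix (transition_deriv c d x)"
  have "det P \<noteq> 0"
    using manifold cd x by (force simp: P_def oriented_manifold_with_boundary_def)
  then obtain Q where Q: "P ** Q = mat 1" by (metis invertible_det_nz invertible_right_inverse)
  show "contract (transition_deriv c d x (B c x)) (volume_form (g d (transition c d x))) =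
      \<beta> d (transition c d x)"
  proof
    fix w :: "nat \<Rightarrow> (real, 'n) vec"
    define v where "v i = Q *v w i" for i
    have w: "w = (\<lambda>i. transition_deriv c d x (v i))"
      using Q by (simp add: v_def transition_deriv_matrix flip: P_def) (simp add: matrix_vector_mul_assoc)
    have "case_nat (transition_deriv c d x (B c x)) w = (\<lambda>i. transition_deriv c d x (case_nat (B c x) v i))"
      unfolding w by (auto split: nat.split)
    then have "contract (transition_deriv c d x (B c x)) (volume_form (g d (transition c d x))) w =
        contract (B c x) (volume_form (g c x)) v"
      by (simp add: contract_def volume_form_transition)
    also have "\<dots> = \<beta> c x v" by (simp add: contract_assoc_field[OF cd(1) transition_in(1)])
    also have "\<dots> = \<beta> d (transition c d x) w"
      unfolding w using form cd x by (simp add: diff_form_def diff_form_on_def)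
    finally show "contract (transition_deriv c d x (B c x)) (volume_form (g d (transition c d x))) w =
        \<beta> d (transition c d x) w" .
  qed
qed

lemma norm_squared_transition:
  "B d (transition c d x) \<bullet> (g d (transition c d x) *v B d (transition c d x)) = B c x \<bullet> (g c x *v B c x)"
  by (simp add: assoc_field_transition metric_transition)

end

lemma diff_form_star: "diff_form A 1 (star g m \<beta>)"
  unfolding diff_form_def diff_form_on_def
proof (intro conjI ballI allI impI)
  fix c x assume "c \<in> A" "x \<in> coord_dom c \<inter> UNIV"
  then show "alternating_form UNIV 1 (star g m \<beta> c x)"
    using alternating_form_inner[of "(-1) ^ m *\<^sub>R (g c x *v B c x)"] by (simp add: star_eq)
next
  fix c and v :: "nat \<Rightarrow> (real, 'n) vec" assume c: "c \<in> A"
  have "smooth_on (coord_dom c) (\<lambda>x. (-1) ^ m * (\<Sum>k\<in>UNIV. (g c x *v B c x) $ k * v 0 $ k))"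
    by (intro smooth_on_mult smooth_on_sum smooth_on_const smooth_flat[OF c])
  then have "smooth_on (coord_dom c) (\<lambda>x. star g m \<beta> c x v)"
    by (rule smooth_on_cong) (simp add: star_eq[OF c] inner_vec_def)
  then show "smooth_on (coord_dom c \<inter> UNIV) (\<lambda>x. star g m \<beta> c x v)" by simp
next
  fix c d x and v :: "nat \<Rightarrow> (real, 'n) vec" assume cd: "c \<in> A" "d \<in> A" "x \<in> overlap c d \<inter> UNIV"
  then have x: "x \<in> overlap c d" by simp
  note T = transition_in[OF cd(1,2) x]
  show "star g m \<beta> c x v = star g m \<beta> d (transition c d x) (\<lambda>i. transition_deriv c d x (v i))"
    unfolding star_eq[OF cd(1) T(1)] star_eq[OF cd(2) T(2)]
    unfolding spd_symmetric[OF spd_metric[OF cd(1) T(1)]] spd_symmetric[OF spd_metric[OF cd(2) T(2)]]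
    by (simp add: assoc_field_transition[OF cd(1,2) x] metric_transition[OF cd(1,2) x])
qed

end

section \<open>Two conformal metrics\<close>

locale conformal_flux =
  hat: flux_form X A ghat \<beta> m + bar: flux_form X A gbar \<beta> m
  for X :: "'m topology" and A :: "('m, 'n::{finite,linorder}) chart set"
    and ghat gbar :: "('m, 'n) metric_field" and \<beta> :: "('m, 'n) form_field" and m :: nat +
  assumes conformal: "\<And>c x. c \<in> A \<Longrightarrow> x \<in> coord_dom c \<Longrightarrow>
    gbar c x = (form_norm (ghat c x) m (\<beta> c x))\<^sup>2 *\<^sub>R ghat c x"
begin

text \<open>The square of the conformal ratio \<open>f\<close>, that is, the conformal factor itself. All powers of
  \<open>f\<close> are taken as real powers of this smooth positive function.\<close>

definition hat_norm_sq :: "('m, 'n) chart \<Rightarrow> (real, 'n) vec \<Rightarrow> real" where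
  "hat_norm_sq c x = hat.B c x \<bullet> (ghat c x *v hat.B c x)"

text \<open>The 1-form \<open>\<alpha>\<close>, dual to the vector field with respect to the first metric.\<close>

definition hat_flat :: "('m, 'n) vec_field" where
  "hat_flat c x = ghat c x *v hat.B c x"

text \<open>The function \<open>h\<close>, which is \<open>f\<close> to the power \<open>2 - n\<close>.\<close>

definition bar_norm :: "('m, 'n) chart \<Rightarrow> (real, 'n) vec \<Rightarrow> real" where
  "bar_norm c x = hat_norm_sq c x powr (1 - CARD('n) / 2)"

context
  fixes c x assumes c: "c \<in> A" and x: "x \<in> coord_dom c"
begin

lemma hat_norm_sq_pos: "0 < hat_norm_sq c x"
  unfolding hat_norm_sq_def by (rule hat.norm_squared_pos[OF c x])

lemma bar_norm_pos: "0 < bar_norm c x"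
  using hat_norm_sq_pos by (simp add: bar_norm_def)

lemma gbar_eq: "gbar c x = hat_norm_sq c x *\<^sub>R ghat c x"
  using conformal[OF c x] hat_norm_sq_pos by (simp add: hat.form_norm_eq[OF c x] hat_norm_sq_def)

text \<open>The conformal factor multiplies each of the \<open>n\<close> rows of the matrix.\<close>

lemma volume_form_gbar: "volume_form (gbar c x) v = hat_norm_sq c x powr (CARD('n) / 2) * volume_form (ghat c x) v"
proof -
  have "det (gbar c x) = hat_norm_sq c x ^ CARD('n) * det (ghat c x)"
    using det_rows_mul[of "\<lambda>_. hat_norm_sq c x" "\<lambda>i. ghat c x $ i"]
    by (simp add: gbar_eq scaleR_vec_def scalar_mult_eq_scaleR)
  moreover have "sqrt (hat_norm_sq c x ^ CARD('n)) = hat_norm_sq c x powr (CARD('n) / 2)"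
    using hat_norm_sq_pos by (simp add: powr_half_sqrt[symmetric] powr_powr flip: powr_realpow)
  ultimately show ?thesis by (simp add: volume_form_eq real_sqrt_mult)
qed

lemma bar_B_eq: "bar.B c x = (hat_norm_sq c x powr (- (CARD('n) / 2))) *\<^sub>R hat.B c x"
proof (rule bar.assoc_field_eqI[OF c x])
  show "contract ((hat_norm_sq c x powr (- (CARD('n) / 2))) *\<^sub>R hat.B c x) (volume_form (gbar c x)) = \<beta> c x"
  proof
    fix v :: "nat \<Rightarrow> (real, 'n) vec"
    interpret linear "\<lambda>b. contract b (volume_form (ghat c x)) v"
      by (rule linear_contract[OF alternating_form_volume[where 'n = 'n, unfolded hat.dim]])
    have "contract ((hat_norm_sq c x powr (- (CARD('n) / 2))) *\<^sub>R hat.B c x) (volume_form (gbar c x)) v =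
        hat_norm_sq c x powr (CARD('n) / 2) * (hat_norm_sq c x powr (- (CARD('n) / 2)) * \<beta> c x v)"
      using scale[of "hat_norm_sq c x powr (- (CARD('n) / 2))" "hat.B c x"] hat.contract_assoc_field[OF c x]
      by (simp add: contract_def volume_form_gbar)
    also have "\<dots> = \<beta> c x v"
      using hat_norm_sq_pos by (simp add: mult.assoc[symmetric] flip: powr_add)
    finally show "contract ((hat_norm_sq c x powr (- (CARD('n) / 2))) *\<^sub>R hat.B c x) (volume_form (gbar c x)) v =
      \<beta> c x v" .
  qed
qed

lemma bar_norm_eq: "bar_norm c x = hat_norm_sq c x * hat_norm_sq c x powr (- (CARD('n) / 2))"
  using hat_norm_sq_pos powr_add[of "hat_norm_sq c x" 1 "- (CARD('n) / 2)"] by (simp add: bar_norm_def)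

lemma bar_flat: "gbar c x *v bar.B c x = bar_norm c x *\<^sub>R hat_flat c x"
  by (simp add: gbar_eq bar_B_eq bar_norm_eq hat_flat_def matrix_vector_mult_scaleR flip: scaleR_matrix_vector_assoc)

lemma bar_unit: "hat_flat c x \<bullet> bar.B c x = bar_norm c x"
  by (simp add: bar_B_eq bar_norm_eq hat_flat_def hat_norm_sq_def inner_commute)

lemma star_hat: "star ghat m \<beta> c x = (\<lambda>v. (-1) ^ m * (hat_flat c x \<bullet> v 0))"
  by (simp add: hat.star_eq[OF c x] hat_flat_def)

lemma star_bar: "star gbar m \<beta> c x v = bar_norm c x * star ghat m \<beta> c x v"
  by (simp add: bar.star_eq[OF c x] star_hat bar_flat)

lemma form_norm_star_bar: "form_norm (gbar c x) 1 (star gbar m \<beta> c x) = bar_norm c x"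
proof -
  let ?b = "(-1) ^ m *\<^sub>R bar.B c x"
  have "star gbar m \<beta> c x = (\<lambda>v. (gbar c x *v ?b) \<bullet> v 0)"
    by (simp add: bar.star_eq[OF c x] matrix_vector_mult_scaleR)
  moreover have "?b \<bullet> (gbar c x *v ?b) = bar_norm c x * bar_norm c x"
  proof -
    have "?b \<bullet> (gbar c x *v ?b) = ((-1) ^ m * (-1) ^ m) * (bar.B c x \<bullet> (gbar c x *v bar.B c x))"
      by (simp only: matrix_vector_mult_scaleR inner_scaleR_left inner_scaleR_right mult.assoc)
    then show ?thesis by (simp add: bar_flat bar_unit inner_commute[of "bar.B c x"] flip: power_add)
  qed
  ultimately show ?thesis
    using form_norm_one_form[OF bar.spd_metric[OF c x], of ?b] bar_norm_pos by simp
qed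

lemma form_norm_star_hat: "form_norm (gbar c x) 1 (star ghat m \<beta> c x) = 1"
proof -
  let ?b = "((-1) ^ m / bar_norm c x) *\<^sub>R bar.B c x"
  have "star ghat m \<beta> c x = (\<lambda>v. (gbar c x *v ?b) \<bullet> v 0)"
    using bar_norm_pos by (simp add: star_hat matrix_vector_mult_scaleR bar_flat)
  moreover have "?b \<bullet> (gbar c x *v ?b) = 1"
  proof -
    have "?b \<bullet> (gbar c x *v ?b) =
        ((-1) ^ m / bar_norm c x * ((-1) ^ m / bar_norm c x)) * (bar.B c x \<bullet> (gbar c x *v bar.B c x))"
      by (simp only: matrix_vector_mult_scaleR inner_scaleR_left inner_scaleR_right mult.assoc)
    then show ?thesis
      using bar_norm_pos by (simp add: bar_flat bar_unit inner_commute[of "bar.B c x"] flip: power_add)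
  qed
  ultimately show ?thesis
    using form_norm_one_form[OF bar.spd_metric[OF c x], of ?b] by simp
qed

lemma smooth_hat_flat: "smooth_on (coord_dom c) (\<lambda>y. hat_flat c y $ k)"
  unfolding hat_flat_def by (rule hat.smooth_flat[OF c])

end

lemma smooth_bar_norm: "c \<in> A \<Longrightarrow> smooth_on (coord_dom c) (bar_norm c)"
  using hat.smooth_norm_squared[of c] hat.norm_squared_pos[of c]
  by (auto simp: bar_norm_def[abs_def] hat_norm_sq_def intro!: smooth_on_powr)

lemma bar_norm_transition: "c \<in> A \<Longrightarrow> d \<in> A \<Longrightarrow> x \<in> overlap c d \<Longrightarrow> bar_norm d (transition c d x) = bar_norm c x"
  by (simp add: bar_norm_def hat_norm_sq_def hat.norm_squared_transition)

subsection \<open>Normalizations\<close>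

text \<open>The star of the form for the second metric is the positive multiple \<open>h\<close> of the star for the
  first, and its norm is \<open>h\<close>; dividing leaves the star for the first metric, which therefore has norm
  \<open>1\<close> for the second.\<close>

lemma normalization_bar_iff:
  "normalization A gbar 1 (star gbar m \<beta>) \<eta> \<longleftrightarrow>
    diff_form A 1 \<eta> \<and> (\<forall>c\<in>A. \<forall>x\<in>coord_dom c. \<eta> c x = star ghat m \<beta> c x)"
proof -
  have "(\<lambda>v. form_norm (gbar c x) 1 (star gbar m \<beta> c x) * \<eta> c x v) = star gbar m \<beta> c x \<longleftrightarrow>
      \<eta> c x = star ghat m \<beta> c x" if "c \<in> A" "x \<in> coord_dom c" for c x
    using bar_norm_pos[OF that] unfolding form_norm_star_bar[OF that] by (simp add: fun_eq_iff star_bar[OF that])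
  then show ?thesis
    by (auto simp: normalization_def form_eq_def form_norm_star_hat[simplified])
qed

lemma harmonic_iff_eikonal: "harmonic A ghat \<beta> \<longleftrightarrow> eikonal A gbar \<beta>"
proof
  assume "harmonic A ghat \<beta>"
  then have "closed_form A 1 (star ghat m \<beta>)"
    by (simp add: harmonic_def closed_form_def hat.dim)
  moreover have "normalization A gbar 1 (star gbar m \<beta>) (star ghat m \<beta>)"
    unfolding normalization_bar_iff using hat.diff_form_star by simp
  ultimately show "eikonal A gbar \<beta>" by (auto simp: eikonal_def hat.dim)
next
  assume "eikonal A gbar \<beta>"
  then obtain \<eta> where "normalization A gbar 1 (star gbar m \<beta>) \<eta>" and closed: "closed_form A 1 \<eta>"
    unfolding eikonal_def hat.dim diff_Suc_1 by blast
  then have "\<And>c x. c \<in> A \<Longrightarrow> x \<in> coord_dom c \<Longrightarrow> \<eta> c x = star ghat m \<beta> c x"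
    unfolding normalization_bar_iff by blast
  then have "ext_d 1 (star ghat m \<beta>) c x = ext_d 1 \<eta> c x" if "c \<in> A" "x \<in> coord_dom c" for c x
    using that by (intro ext_d_cong) auto
  then show "harmonic A ghat \<beta>"
    using closed by (simp add: harmonic_def closed_form_def form_eq_def hat.dim)
qed

subsection \<open>Potentials\<close>

text \<open>The star is injective on 1-forms: \<open>\<beta> = \<star>du\<close> says that the vector field is the
  gradient of \<open>u\<close>.\<close>

lemma star_differential_eq_iff:
  assumes c: "c \<in> A" "x \<in> coord_dom c" and u: "smooth_fun A u"
  shows "\<beta> c x = star ghat 1 (ext_d 0 (fun_form u)) c x \<longleftrightarrow>
    (\<forall>v. hat_flat c x \<bullet> v = frechet_derivative (\<lambda>y. u (param c y)) (at x within coord_dom c) v)"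
proof -
  let ?D = "frechet_derivative (\<lambda>y. u (param c y)) (at x within coord_dom c)"
  note G = hat.spd_metric[OF c]
  have diff: "(\<lambda>y. u (param c y)) differentiable (at x within coord_dom c)"
    using u c by (intro smooth_on_differentiable) (auto simp: smooth_fun_def)
  define b where "b = matrix_inv (ghat c x) *v (\<chi> i. partial_deriv (coord_dom c) i (\<lambda>y. u (param c y)) x)"
  have D: "?D v = (ghat c x *v b) \<bullet> v" for v
    unfolding b_def spd_inverse[OF G] frechet_derivative_eq_sum_partial_deriv[OF diff]
    by (simp add: inner_vec_def mult.commute)
  have "star ghat 1 (ext_d 0 (fun_form u)) c x = contract b (volume_form (ghat c x))"
    unfolding star_def ext_d_fun_form[abs_def] D by (rule hodge_one_form[OF G])
  then have "\<beta> c x = star ghat 1 (ext_d 0 (fun_form u)) c x \<longleftrightarrow> hat.B c x = b"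
    using hat.contract_assoc_field[OF c] contract_volume_inject[OF G] by metis
  also have "\<dots> \<longleftrightarrow> hat_flat c x = ghat c x *v b"
    unfolding hat_flat_def using spd_inverse(2)[OF G] by metis
  also have "\<dots> \<longleftrightarrow> (\<forall>v. hat_flat c x \<bullet> v = ?D v)"
    unfolding D by (metis vector_eq_rdot)
  finally show ?thesis .
qed

text \<open>A potential of \<open>\<alpha>\<close> and a potential of \<open>\<star>\<beta> = (-1)\<^sup>m \<alpha>\<close> differ by the sign.\<close>

lemma exact_harmonic_iff_exact_eikonal: "exact_harmonic A ghat \<beta> \<longleftrightarrow> exact_eikonal A gbar \<beta>"
proof -
  let ?D = "\<lambda>u c x. frechet_derivative (\<lambda>y. u (param c y)) (at x within coord_dom c)"
  have harm: "exact_harmonic A ghat \<beta> \<longleftrightarrow>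
      (\<exists>u. smooth_fun A u \<and> (\<forall>c\<in>A. \<forall>x\<in>coord_dom c. \<forall>v. hat_flat c x \<bullet> v = ?D u c x v))"
    using star_differential_eq_iff unfolding exact_harmonic_def form_eq_def by blast
  have eq: "star ghat m \<beta> c x = ext_d 0 (fun_form u) c x \<longleftrightarrow> (\<forall>v. (-1) ^ m * (hat_flat c x \<bullet> v) = ?D u c x v)"
    if "c \<in> A" "x \<in> coord_dom c" for c x u
    unfolding star_hat[OF that] ext_d_fun_form[abs_def]
    by (auto simp: fun_eq_iff dest: spec[of _ "\<lambda>_. _"])
  have "exact_eikonal A gbar \<beta> \<longleftrightarrow> exact_one_form A (star ghat m \<beta>)"
    unfolding exact_eikonal_def hat.dim diff_Suc_1 normalization_bar_iff
    using hat.diff_form_star by (auto simp: exact_one_form_def form_eq_def)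
  then have eik: "exact_eikonal A gbar \<beta> \<longleftrightarrow>
      (\<exists>u. smooth_fun A u \<and> (\<forall>c\<in>A. \<forall>x\<in>coord_dom c. \<forall>v. (-1) ^ m * (hat_flat c x \<bullet> v) = ?D u c x v))"
    unfolding exact_one_form_def form_eq_def using eq by simp
  have smooth: "smooth_fun A (\<lambda>p. (-1) ^ m * u p)" if "smooth_fun A u" for u
    using that by (simp add: smooth_fun_def smooth_on_mult smooth_on_const)
  have D_sign: "?D (\<lambda>p. (-1) ^ m * u p) c x v = (-1) ^ m * ?D u c x v"
    if "smooth_fun A u" "c \<in> A" "x \<in> coord_dom c" for u c x v
  proof -
    have "(\<lambda>y. u (param c y)) differentiable (at x within coord_dom c)"
      using that by (intro smooth_on_differentiable) (auto simp: smooth_fun_def)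
    then have "((\<lambda>y. (-1) ^ m * u (param c y)) has_derivative (\<lambda>v. (-1) ^ m * ?D u c x v))
        (at x within coord_dom c)"
      by (intro has_derivative_mult_right frechet_derivative_works[THEN iffD1])
    from half_space_frechet_derivativeI[OF hat.openin_coord_dom that(3) this] show ?thesis
      using that by simp
  qed
  have cancel: "(-1) ^ m * ((-1) ^ m * r) = r" for r :: real by (cases "even m") simp_all
  show ?thesis
    unfolding harm eik
  proof
    assume "\<exists>u. smooth_fun A u \<and> (\<forall>c\<in>A. \<forall>x\<in>coord_dom c. \<forall>v. hat_flat c x \<bullet> v = ?D u c x v)"
    then obtain u where "smooth_fun A u" "\<forall>c\<in>A. \<forall>x\<in>coord_dom c. \<forall>v. hat_flat c x \<bullet> v = ?D u c x v"
      by blast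
    then show "\<exists>u. smooth_fun A u \<and> (\<forall>c\<in>A. \<forall>x\<in>coord_dom c. \<forall>v. (-1) ^ m * (hat_flat c x \<bullet> v) = ?D u c x v)"
      by (intro exI[of _ "\<lambda>p. (-1) ^ m * u p"]) (simp add: smooth D_sign)
  next
    assume "\<exists>u. smooth_fun A u \<and> (\<forall>c\<in>A. \<forall>x\<in>coord_dom c. \<forall>v. (-1) ^ m * (hat_flat c x \<bullet> v) = ?D u c x v)"
    then obtain u where u: "smooth_fun A u"
      "\<forall>c\<in>A. \<forall>x\<in>coord_dom c. \<forall>v. (-1) ^ m * (hat_flat c x \<bullet> v) = ?D u c x v"
      by blast
    have "hat_flat c x \<bullet> v = (-1) ^ m * ?D u c x v" if "c \<in> A" "x \<in> coord_dom c" for c x v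
      using u(2) that cancel[of "hat_flat c x \<bullet> v"] by simp
    then show "\<exists>u. smooth_fun A u \<and> (\<forall>c\<in>A. \<forall>x\<in>coord_dom c. \<forall>v. hat_flat c x \<bullet> v = ?D u c x v)"
      using u(1) by (intro exI[of _ "\<lambda>p. (-1) ^ m * u p"]) (simp add: smooth D_sign)
  qed
qed

subsection \<open>Field lines\<close>

text \<open>The components of \<open>d\<alpha>\<close>.\<close>

definition curl :: "('m, 'n) chart \<Rightarrow> (real, 'n) vec \<Rightarrow> 'n \<Rightarrow> 'n \<Rightarrow> real" where
  "curl c x i l = partial_deriv (coord_dom c) i (\<lambda>y. hat_flat c y $ l) x -
     partial_deriv (coord_dom c) l (\<lambda>y. hat_flat c y $ i) x"

text \<open>The two vector fields are positive multiples of each other, so it does not matter which of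
  them is inserted into \<open>d\<alpha>\<close>.\<close>

lemma force_free_iff:
  "force_free A ghat \<beta> \<longleftrightarrow>
    (\<forall>c\<in>A. \<forall>x\<in>coord_dom c. \<forall>l. (\<Sum>i\<in>UNIV. bar.B c x $ i * curl c x i l) = 0)"
proof -
  have "contract (hat.B c x) (ext_d 1 (star ghat m \<beta>) c x) = zero_form c x \<longleftrightarrow>
      (\<forall>l. (\<Sum>i\<in>UNIV. bar.B c x $ i * curl c x i l) = 0)" (is "?L \<longleftrightarrow> ?R")
    if c: "c \<in> A" "x \<in> coord_dom c" for c x
  proof -
    let ?K = "\<lambda>l. \<Sum>i\<in>UNIV. hat.B c x $ i * curl c x i l"
    have K: "contract (hat.B c x) (ext_d 1 (star ghat m \<beta>) c x) v = (-1) ^ m * (\<Sum>l\<in>UNIV. v 0 $ l * ?K l)" for v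
      using ext_d_one_form[where \<omega> = "star ghat m \<beta>" and a = "hat_flat c" and s = "(-1) ^ m"
          and v = "case_nat (hat.B c x) v", OF hat.openin_coord_dom[OF c(1)] c(2) star_hat[OF c(1)]
          smooth_on_differentiable[OF smooth_hat_flat[OF c] c(2)]]
      by (simp add: contract_def curl_def)
    have "?L \<longleftrightarrow> (\<forall>l. ?K l = 0)"
    proof
      assume ?L
      then have "contract (hat.B c x) (ext_d 1 (star ghat m \<beta>) c x) (\<lambda>_. axis l 1) = 0" for l
        by (simp add: zero_form_def)
      then show "\<forall>l. ?K l = 0" unfolding K by (simp add: axis_def if_distrib[of "\<lambda>t. t * _"] cong: if_cong)
    next
      assume "\<forall>l. ?K l = 0"
      then show ?L using K by (simp add: fun_eq_iff zero_form_def)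
    qed
    also have "(\<Sum>i\<in>UNIV. bar.B c x $ i * curl c x i l) = hat_norm_sq c x powr (- (CARD('n) / 2)) * ?K l" for l
      by (simp add: bar_B_eq[OF c] sum_distrib_left mult.assoc)
    then have "(\<forall>l. ?K l = 0) \<longleftrightarrow> ?R" using hat_norm_sq_pos[OF c] by simp
    finally show ?thesis .
  qed
  then show ?thesis by (simp add: force_free_def form_eq_def hat.dim)
qed

text \<open>The only possible coefficient \<open>r\<close> in \<open>\<nabla>\<^sub>Y Y = r Y\<close>: the logarithmic derivative, along \<open>Y\<close>, of
  the norm \<open>h\<close> of \<open>Y\<close>.\<close>

definition rate :: "('m, 'n) chart \<Rightarrow> (real, 'n) vec \<Rightarrow> real" where
  "rate c x = frechet_derivative (bar_norm c) (at x within coord_dom c) (bar.B c x) / bar_norm c x"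

text \<open>The acceleration of a unit vector field is orthogonal to it, so the component along the
  field lines and the component \<open>\<iota>\<^sub>Y d\<alpha>\<close> can be compared separately: inserting \<open>Y\<close> into the lowered
  equation removes the latter and determines \<open>r\<close>.\<close>

lemma levi_civita_parallel_iff:
  assumes c: "c \<in> A" "x \<in> coord_dom c"
  shows "levi_civita gbar bar.B bar.B c x = r *\<^sub>R bar.B c x \<longleftrightarrow>
    r = rate c x \<and> (\<forall>l. (\<Sum>i\<in>UNIV. bar.B c x $ i * curl c x i l) = 0)"
    (is "?L \<longleftrightarrow> r = _ \<and> (\<forall>l. ?K l = 0)")
proof -
  note G = bar.spd_metric[OF c]
  have hd: "bar_norm c differentiable (at x within coord_dom c)"
    by (rule smooth_on_differentiable[OF smooth_bar_norm[OF c(1)] c(2)])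
  have LC: "(gbar c x *v levi_civita gbar bar.B bar.B c x) $ l =
      frechet_derivative (bar_norm c) (at x within coord_dom c) (bar.B c x) * hat_flat c x $ l + bar_norm c x * ?K l" for l
    unfolding frechet_derivative_eq_sum_partial_deriv[OF hd] curl_def
    by (intro levi_civita_lowered hat.openin_coord_dom c hd bar.spd_metric bar_flat bar_unit
        smooth_on_differentiable[OF bar.smooth_metric] smooth_on_differentiable[OF bar.smooth_assoc_field]
        smooth_on_differentiable[OF smooth_hat_flat[OF c]])
  have "?L \<longleftrightarrow> gbar c x *v levi_civita gbar bar.B bar.B c x = gbar c x *v (r *\<^sub>R bar.B c x)"
    using spd_inverse(2)[OF G] by metis
  also have "\<dots> \<longleftrightarrow> (\<forall>l. rate c x * bar_norm c x * hat_flat c x $ l + bar_norm c x * ?K l = r * bar_norm c x * hat_flat c x $ l)"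
    using bar_norm_pos[OF c]
    by (simp add: vec_eq_iff[of "gbar c x *v _"] LC matrix_vector_mult_scaleR bar_flat[OF c] rate_def)
  also have "\<dots> \<longleftrightarrow> r = rate c x \<and> (\<forall>l. ?K l = 0)"
  proof
    assume *: "\<forall>l. rate c x * bar_norm c x * hat_flat c x $ l + bar_norm c x * ?K l = r * bar_norm c x * hat_flat c x $ l"
    have unit: "(\<Sum>l\<in>UNIV. bar.B c x $ l * hat_flat c x $ l) = bar_norm c x"
      using bar_unit[OF c] by (simp add: inner_vec_def mult.commute)
    have "(\<Sum>l\<in>UNIV. bar.B c x $ l * (rate c x * bar_norm c x * hat_flat c x $ l + bar_norm c x * ?K l)) =
        rate c x * bar_norm c x * (\<Sum>l\<in>UNIV. bar.B c x $ l * hat_flat c x $ l) + bar_norm c x * (\<Sum>l\<in>UNIV. bar.B c x $ l * ?K l)"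
      by (simp add: distrib_left sum.distrib sum_distrib_left mult_ac)
    also have "(\<Sum>l\<in>UNIV. bar.B c x $ l * ?K l) = 0"
      unfolding curl_def by (rule sum_antisymmetric)
    finally have "rate c x * bar_norm c x * bar_norm c x = (\<Sum>l\<in>UNIV. bar.B c x $ l * (r * bar_norm c x * hat_flat c x $ l))"
      using * unit by simp
    also have "\<dots> = r * bar_norm c x * bar_norm c x"
      using unit by (simp add: mult.left_commute mult.assoc flip: sum_distrib_left)
    finally have "r = rate c x" using bar_norm_pos[OF c] by simp
    then show "r = rate c x \<and> (\<forall>l. ?K l = 0)" using * bar_norm_pos[OF c] by simp
  qed simp
  finally show ?thesis .
qed

lemma rate_transition:
  assumes "c \<in> A" "d \<in> A" "x \<in> overlap c d"
  shows "rate d (transition c d x) = rate c x"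
proof -
  note T = bar.transition_in[OF assms]
  have "frechet_derivative (bar_norm c) (at x within coord_dom c) v =
      frechet_derivative (bar_norm d) (at (transition c d x) within coord_dom d) (transition_deriv c d x v)" for v
    by (intro frechet_derivative_transition[OF hat.manifold assms]
        smooth_on_differentiable[OF smooth_bar_norm] assms T) (simp add: bar_norm_transition assms)
  then show ?thesis
    by (simp add: rate_def bar_norm_transition[OF assms] bar.assoc_field_transition[OF assms])
qed

lemma smooth_rate:
  assumes c: "c \<in> A"
  shows "smooth_on (coord_dom c) (rate c)"
proof -
  have "smooth_on (coord_dom c) (\<lambda>x. (\<Sum>i\<in>UNIV. bar.B c x $ i *
      frechet_derivative (bar_norm c) (at x within coord_dom c) (axis i 1)) * bar_norm c x powr (-1))"
    by (intro smooth_on_mult smooth_on_sum smooth_on_powr smooth_bar_norm bar.smooth_assoc_field c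
        smooth_on_frechet_derivative hat.openin_coord_dom bar_norm_pos)
  then show ?thesis
  proof (rule smooth_on_cong)
    fix x assume x: "x \<in> coord_dom c"
    have "frechet_derivative (bar_norm c) (at x within coord_dom c) (bar.B c x) = (\<Sum>i\<in>UNIV. bar.B c x $ i *
        frechet_derivative (bar_norm c) (at x within coord_dom c) (axis i 1))"
      by (rule frechet_derivative_eq_sum_partial_deriv[OF smooth_on_differentiable[OF smooth_bar_norm[OF c] x],
          unfolded partial_deriv_def])
    then show "(\<Sum>i\<in>UNIV. bar.B c x $ i * frechet_derivative (bar_norm c) (at x within coord_dom c) (axis i 1)) *
        bar_norm c x powr (-1) = rate c x"
      using bar_norm_pos[OF c x] by (simp add: rate_def powr_minus divide_inverse)
  qed
qed

text \<open>The local functions agree on overlaps, so the value at a point may be computed in any chart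
  around it.\<close>

lemma ex_global_rate: "\<exists>\<rho>. smooth_fun A \<rho> \<and> (\<forall>c\<in>A. \<forall>x\<in>coord_dom c. \<rho> (param c x) = rate c x)"
proof -
  define chart_at where "chart_at p = (SOME c. c \<in> A \<and> p \<in> fst c)" for p
  define \<rho> where "\<rho> p = rate (chart_at p) (snd (chart_at p) p)" for p
  have \<rho>: "\<rho> (param c x) = rate c x" if c: "c \<in> A" and x: "x \<in> coord_dom c" for c x
  proof -
    obtain p where p: "p \<in> fst c" "x = snd c p" using x by (auto simp: coord_dom_def)
    have "chart_at p \<in> A \<and> p \<in> fst (chart_at p)"
      unfolding chart_at_def by (rule someI[where x = c]) (use c p in simp)
    then have d: "chart_at p \<in> A" "x \<in> overlap c (chart_at p)" using p by (auto simp: overlap_def)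
    have "param c x = p" using param_coord[OF hat.chart[OF c] p(1)] p(2) by simp
    then show ?thesis
      using rate_transition[OF c d] by (simp add: \<rho>_def transition_def)
  qed
  moreover have "smooth_fun A \<rho>"
    unfolding smooth_fun_def
    using smooth_on_cong[OF smooth_rate] \<rho> by (metis (no_types, lifting))
  ultimately show ?thesis by blast
qed

lemma force_free_iff_geodesic: "force_free A ghat \<beta> \<longleftrightarrow> geodesic_form A gbar \<beta>"
proof
  assume "force_free A ghat \<beta>"
  moreover obtain \<rho> where "smooth_fun A \<rho>" "\<forall>c\<in>A. \<forall>x\<in>coord_dom c. \<rho> (param c x) = rate c x"
    using ex_global_rate by blast
  ultimately show "geodesic_form A gbar \<beta>"
    unfolding geodesic_form_def force_free_iff
    by (intro exI[of _ \<rho>]) (simp add: levi_civita_parallel_iff)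
next
  assume "geodesic_form A gbar \<beta>"
  then show "force_free A ghat \<beta>"
    unfolding geodesic_form_def force_free_iff using levi_civita_parallel_iff by blast
qed

end

theorem theorem5p3:
  fixes X :: "'m topology"
    and A :: "('m, 'n::{finite,linorder}) chart set"
    and C :: "('m, 'n) metric_field set"
    and ghat gbar :: "('m, 'n) metric_field"
    and \<beta> \<beta>bd :: "('m, 'n) form_field"
  assumes "CARD('n) \<ge> 3"
    and "oriented_manifold_with_boundary X A"
    and "conformal_class A C"
    and "diff_form A (CARD('n) - 1) \<beta>"
    and "closed_form A (CARD('n) - 1) \<beta>"
    and "nowhere_vanishing A \<beta>"
    and "boundary_diff_form A (CARD('n) - 1) \<beta>bd"
    and "boundary_pullback_eq A \<beta> \<beta>bd"
    and "ghat \<in> C" and "gbar \<in> C"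
    and "\<And>c x. c \<in> A \<Longrightarrow> x \<in> coord_dom c \<Longrightarrow>
           gbar c x = (form_norm (ghat c x) (CARD('n) - 1) (\<beta> c x))\<^sup>2 *\<^sub>R ghat c x"
  shows "(force_free A ghat \<beta> \<longleftrightarrow> geodesic_form A gbar \<beta>) \<and>
         (harmonic A ghat \<beta> \<longleftrightarrow> eikonal A gbar \<beta>) \<and>
         (exact_harmonic A ghat \<beta> \<longleftrightarrow> exact_eikonal A gbar \<beta>)"
proof -
  have "riemannian_metric A ghat" "riemannian_metric A gbar"
    using assms(3,9,10) by (auto simp: conformal_class_def)
  then interpret conformal_flux X A ghat gbar \<beta> "CARD('n) - 1"
    using assms by unfold_locales auto
  show ?thesis
    using force_free_iff_geodesic harmonic_iff_eikonal exact_harmonic_iff_exact_eikonal by blast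
qed

end
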